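(* Let $\theta_0=(\mathbf W_0,\sigma_0^2)\in\Theta$ be the true parameter, let $X_1,X_2,\ldots$ be i.i.d. random vectors in $\mathbb R^p$ with density $f(\cdot;\theta_0)$, and let $\Theta_0$ be a compact subset of $\Theta$ containing the point $\theta_0$. Let $\theta_n=(\widehat{\mathbf W},\widehat\sigma^2)$ denote the sequence of maximum likelihood estimates of the PPCA model based on $X_1,\ldots,X_n$. Then, as $n\to\infty$, $$\mathbb P\left(\widehat{\mathbf W}\widehat{\mathbf W}^T+\widehat\sigma^2I_p\to\mathbf W_0\mathbf W_0^T+\sigma_0^2I_p\right)=1.$$
   Context: Let $p>q$ be positive integers, $\mathbb R_+=(0,\infty)$, and $\Theta=\{\theta=(\mathbf W_\theta,\sigma_\theta^2)\in\mathbb R^{p\times q}\times\mathbb R_+\}$, viewed as a subset of $\mathbb R^{pq+1}$. For $\theta\in\Theta$, $f(\cdot;\theta)$ is the density on $\mathbb R^p$ of the normal distribution $\mathcal N(0,\mathbf W_\theta\mathbf W_\theta^T+\sigma_\theta^2 I_p)$ (the marginal density of the probabilistic PCA model). $\mathbb P$ is the probability under $\theta_0$. A maximum likelihood estimate of the PPCA model based on $X_1,\ldots,X_n$ is a measurable $\theta_n=\theta_n(X_1,\ldots,X_n)=(\widehat{\mathbf W},\widehat\sigma^2)\in\Theta$ that maximizes $\theta\mapsto\prod_{i=1}^n f(X_i;\theta)$ over $\Theta$ whenever a maximizer exists. (Maximizers are not unique: with $\delta_1\ge\dots\ge\delta_p$ the eigenvalues of $\frac1n\sum_{i=1}^n X_iX_i^T$,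 the estimates are $\widehat\sigma^2=\frac1{p-q}\sum_{j=q+1}^p\delta_j$ and $\widehat{\mathbf W}=\mathbf U(\mathrm{diag}(\delta_1,\ldots,\delta_q)-\widehat\sigma^2I_q)^{1/2}\mathbf R$, where the columns of $\mathbf U$ are orthonormal eigenvectors for $\delta_1,\ldots,\delta_q$ and $\mathbf R$ is any $q\times q$ orthogonal matrix.) *)

theory Defs
  imports "HOL-Probability.Probability"
begin

text \<open>
  A parameter is a pair \<open>\<theta> = (W, s)\<close>, where \<open>W :: real^'q^'p\<close> is a matrix with \<open>CARD('p)\<close> rows
  and \<open>CARD('q)\<close> columns, and \<open>s\<close> is the variance \<open>\<sigma>\<^sup>2\<close> (not the standard deviation).
\<close>

definition ppca_params :: "((real^'q^'p) \<times> real) set"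
  where "ppca_params = UNIV \<times> {0<..}"

definition ppca_cov :: "(real^'q^'p) \<times> real \<Rightarrow> real^'p^'p"
  where "ppca_cov \<theta> = fst \<theta> ** transpose (fst \<theta>) + snd \<theta> *\<^sub>R mat 1"

text \<open>Lebesgue density of \<open>N(0, S)\<close>; meaningful for positive definite \<open>S\<close> only.\<close>

definition centered_normal_density :: "real^'p^'p \<Rightarrow> real^'p \<Rightarrow> real"
  where "centered_normal_density S x =
    exp (- (x \<bullet> (matrix_inv S *v x)) / 2) / sqrt ((2 * pi) ^ CARD('p) * det S)"

definition ppca_density :: "(real^'q^'p) \<times> real \<Rightarrow> real^'p \<Rightarrow> real"
  where "ppca_density \<theta> = centered_normal_density (ppca_cov \<theta>)"

definition ppca_likelihood :: "nat \<Rightarrow> (nat \<Rightarrow> real^'p) \<Rightarrow> (real^'q^'p) \<times> real \<Rightarrow> real"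
  where "ppca_likelihood n x \<theta> = (\<Prod>i<n. ppca_density \<theta> (x i))"

text \<open>
  An estimator is a function \<open>T\<close> of the sample \<open>x 0, \<dots>, x (n - 1)\<close>. Maximizers are not unique, so
  being a maximum likelihood estimate is a property of \<open>T\<close>. For some samples the likelihood
  has no maximizer; there \<open>T\<close> takes arbitrary values in the parameter set.
\<close>

definition ppca_mle :: "nat \<Rightarrow> ((nat \<Rightarrow> real^'p) \<Rightarrow> (real^'q^'p) \<times> real) \<Rightarrow> bool"
  where "ppca_mle n T \<longleftrightarrow>
    T \<in> borel_measurable (Pi\<^sub>M {..<n} (\<lambda>_. borel)) \<and>
    (\<forall>x \<in> space (Pi\<^sub>M {..<n} (\<lambda>_. borel)).
      T x \<in> ppca_params \<and>
      ((\<exists>\<theta> :: (real^'q^'p) \<times> real. is_arg_max (ppca_likelihood n x) (\<lambda>\<theta>. \<theta> \<in> ppca_params) \<theta>) \<longrightarrow>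
        is_arg_max (ppca_likelihood n x) (\<lambda>\<theta>. \<theta> \<in> ppca_params) (T x)))"

end

theory Submission
  imports Defs
begin

text \<open>
  Let \<open>C\<close> be the true covariance. The second moments \<open>(1/n) \<Sum> (w \<bullet> X\<^sub>i)\<^sup>2\<close> converge
  almost surely to \<open>w \<bullet> C w\<close>, by a Chernoff bound and Borel--Cantelli, and hence do so uniformly
  in \<open>w\<close> relative to \<open>w \<bullet> C w\<close>. Once they are close, diagonalizing \<open>C\<close> and a competing
  covariance \<open>D\<close> simultaneously shows that \<open>D\<close> can have a likelihood at least that of \<open>C\<close>
  only if \<open>D\<close> is close to \<open>C\<close>. This confines the parameters that beat the true one to a
  compact set, so a maximizer exists for all large \<open>n\<close>, and it forces the estimated covariance to
  converge to \<open>C\<close>.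
\<close>

text \<open>The law determines W only up to a rotation, and the parameter set is not compact, so the
  argument does not follow the parameters themselves: it compares covariances through their
  quadratic forms. Of an estimate it uses only that it lies in \<open>ppca_params\<close> and that
  its likelihood is at least that of \<open>\<theta>\<^sub>0\<close>, never the spectral formula.
  \<open>ppca_mle\<close> makes an estimate a maximizer only on samples that have one, which is why
  existence must be proved along the way.

  Measuring errors relative to the form of C makes the comparison invariant under linear changes of
  coordinates. After diagonalization only the ratios of the two forms remain, so a tolerance
  \<epsilon> depending on \<delta> and the dimension alone serves every pair of covariances. The
  comparison is deterministic; probability enters only through the second moments. Their Chernoff
  bound needs the Laplace transform of a squared projection, which comes from the effect on Lebesgue
  measure of maps that add to x a fixed vector times a linear functional of x.\<close>

section \<open>Rank-one linear changes of variables\<close>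

text \<open>
  The linear change of variables of \<open>HOL-Analysis\<close> needs a well-ordered index type; \<open>'a wo_index\<close>
  is one with as many elements as \<open>'a\<close>, and results are carried over by reindexing coordinates.
\<close>

typedef ('a::finite) wo_index = "{..<CARD('a)}"
  by (rule exI[of _ 0]) auto

setup_lifting type_definition_wo_index

instantiation wo_index :: (finite) linorder
begin
lift_definition less_eq_wo_index :: "'a wo_index \<Rightarrow> 'a wo_index \<Rightarrow> bool" is "(\<le>)" .
lift_definition less_wo_index :: "'a wo_index \<Rightarrow> 'a wo_index \<Rightarrow> bool" is "(<)" .
instance by standard (transfer; auto)+
end

lemma UNIV_wo_index: "(UNIV :: 'a::finite wo_index set) = Abs_wo_index ` {..<CARD('a)}"
  by (rule type_definition.Abs_image[OF type_definition_wo_index, symmetric])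

instance wo_index :: (finite) finite
  by standard (simp add: UNIV_wo_index)

instance wo_index :: (finite) wellorder
proof
  fix P :: "'a wo_index \<Rightarrow> bool" and a
  assume step: "\<And>x. (\<And>y. y < x \<Longrightarrow> P y) \<Longrightarrow> P x"
  show "P a"
  proof (induction "Rep_wo_index a" arbitrary: a rule: less_induct)
    case less
    show ?case by (rule step, rule less) (simp only: less_wo_index.rep_eq)
  qed
qed

lemma card_wo_index: "CARD('a::finite wo_index) = CARD('a)"
  using type_definition.card[OF type_definition_wo_index[where ?'a = 'a]] by simp

text \<open>This is the matrix determinant lemma. Rotating \<open>w\<close> onto a coordinate axis
  leaves a matrix that differs from the identity in one column only.\<close>

lemma det_rank_one_update:
  fixes u w :: "real^'n"
  shows "det (mat 1 + (\<chi> i j. u $ i * w $ j)) = 1 + w \<bullet> u"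
proof (cases "w = 0")
  case False
  fix k :: 'n
  define e where "e = (1 / norm w) *\<^sub>R w"
  have "norm e = 1" using False by (simp add: e_def)
  then obtain Q where Q: "orthogonal_matrix Q" "Q *v axis k 1 = e"
    using orthogonal_matrix_exists_basis by blast
  define v where "v = norm w *\<^sub>R (transpose Q *v u)"
  have w: "w = norm w *\<^sub>R (Q *v axis k 1)"
    unfolding Q(2) e_def using False by simp
  have QQ: "transpose Q ** Q = mat 1" "Q ** transpose Q = mat 1"
    using Q(1) by (auto simp: orthogonal_matrix_def)
  \<comment> \<open>The right-hand side is the identity with column \<open>k\<close> replaced by
    \<open>axis k 1 + v\<close>, in exactly the shape whose determinant \<open>cramer_lemma\<close>
    evaluates.\<close>
  have "transpose Q ** (mat 1 + (\<chi> i j. u $ i * w $ j)) ** Q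
      = (\<chi> i j. if j = k then (mat 1 *v (axis k 1 + v)) $ i else mat 1 $ i $ j)"
  proof -
    have "transpose Q ** (mat 1 + (\<chi> i j. u $ i * w $ j)) ** Q *v x = x + (w \<bullet> (Q *v x)) *\<^sub>R (transpose Q *v u)" for x
    proof -
      have "(\<chi> i j. u $ i * w $ j) *v y = (w \<bullet> y) *\<^sub>R u" for y
        by (simp add: vec_eq_iff matrix_vector_mult_def inner_vec_def sum_distrib_left sum_distrib_right mult_ac)
      then show ?thesis
        by (simp add: matrix_vector_mul_assoc[symmetric] matrix_vector_mult_add_rdistrib 
           matrix_vector_right_distrib QQ  matrix_vector_mult_scaleR del: transpose_matrix_vector)
           (simp add: matrix_vector_mul_assoc QQ)
    qed
    moreover have "w \<bullet> (Q *v x) = norm w * x $ k" for x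
    proof -
      have "w \<bullet> (Q *v x) = norm w * ((Q *v axis k 1) \<bullet> (Q *v x))" by (subst w) simp
      also have "(Q *v axis k 1) \<bullet> (Q *v x) = axis k 1 \<bullet> x"
        using Q(1) orthogonal_transformation_matrix[of "(*v) Q"] by (simp add: orthogonal_transformation_def)
      finally show ?thesis by (simp add: inner_axis')
    qed
    moreover have "(\<chi> i j. if j = k then (mat 1 *v (axis k 1 + v)) $ i else (mat 1 :: real^'n^'n) $ i $ j) *v x = x + x $ k *\<^sub>R v" for x
    proof -
      have *: "(if j = k then (axis k 1 + v) $ i else (mat 1 :: real^'n^'n) $ i $ j) * x $ j
        = (if i = j then x $ j else 0) + (if k = j then x $ k * v $ i else 0)" for i j
        by (auto simp: mat_def axis_def algebra_simps)
      show ?thesis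
        unfolding matrix_vector_mul_lid
        by (simp add: vec_eq_iff matrix_vector_mult_def * sum.distrib)
    qed
    ultimately show ?thesis
      by (simp add: matrix_eq v_def mult.commute)
  qed
  then have "det (transpose Q ** (mat 1 + (\<chi> i j. u $ i * w $ j)) ** Q) = (axis k 1 + v) $ k * det (mat 1 :: real^'n^'n)"
    by (simp only: cramer_lemma)
  also have "det (transpose Q ** (mat 1 + (\<chi> i j. u $ i * w $ j)) ** Q) = det (mat 1 + (\<chi> i j. u $ i * w $ j)) * det (transpose Q ** Q)"
    by (simp add: det_mul)
  finally have "det (mat 1 + (\<chi> i j. u $ i * w $ j)) = 1 + v $ k" by (simp add: QQ)
  moreover have "v $ k = w \<bullet> u"
  proof -
    have "w \<bullet> u = norm w * ((Q *v axis k 1) \<bullet> u)" by (subst w) simp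
    also have "(Q *v axis k 1) \<bullet> u = axis k 1 \<bullet> (transpose Q *v u)"
      by (metis dot_lmul_matrix transpose_matrix_vector transpose_transpose)
    finally show ?thesis by (simp add: v_def inner_axis')
  qed
  ultimately show ?thesis by simp
next
  case True
  then have "(\<chi> i j. u $ i * w $ j) = (0 :: real^'n^'n)" by (simp add: vec_eq_iff)
  then show ?thesis using True by simp
qed

lemma lborel_rank_one_update_wellorder:
  fixes u w :: "real^'n::{finite,wellorder}"
  assumes "1 + w \<bullet> u > 0"
  shows "distr lborel borel (\<lambda>x. x + (w \<bullet> x) *\<^sub>R u) = density lborel (\<lambda>_. ennreal (1 / (1 + w \<bullet> u)))"
proof -
  define c where "c = 1 + w \<bullet> u"
  have c: "c > 0" using assms by (simp add: c_def)
  \<comment> \<open>The Sherman-Morrison inverse of the map. It is needed because the volume formula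
    for linear maps concerns images, whereas \<open>distr\<close> involves preimages.\<close>
  define S where "S = (\<lambda>x::real^'n::_. x + (w \<bullet> x) *\<^sub>R (- (1 / c) *\<^sub>R u))"
  define A where "A = mat 1 + (\<chi> i j. (- (1 / c) *\<^sub>R u) $ i * w $ j)"
  have SA: "S = (*v) A"
    by (auto simp: S_def A_def fun_eq_iff vec_eq_iff matrix_vector_mult_add_rdistrib
      matrix_vector_mult_def[of "vec_lambda _"] inner_vec_def sum_distrib_left sum_distrib_right mult_ac
      sum_negf sum_divide_distrib intro!: sum.cong)
  have S: "linear S" unfolding SA by simp
  have "det A = 1 / c"
    unfolding A_def det_rank_one_update using c by (simp add: field_simps c_def)
  then have detS: "\<bar>det (matrix S)\<bar> = 1 / c" using c by (simp add: SA)
  have "ennreal c * ennreal (1 / c) = ennreal (c * (1 / c))"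
    by (rule ennreal_mult[symmetric]) (use c in auto)
  then have cc: "ennreal c * ennreal (1 / c) = 1" using c by simp
  let ?T = "\<lambda>x. x + (w \<bullet> x) *\<^sub>R u"
  have ST: "S (?T x) = x" and TS: "?T (S x) = x" for x
  proof -
    have "w \<bullet> ?T x = c * (w \<bullet> x)" by (simp add: c_def inner_add_right algebra_simps)
    then show "S (?T x) = x" unfolding S_def using c by simp
    have "w \<bullet> S x = (w \<bullet> x) / c" unfolding S_def
      using c by (simp add: c_def inner_add_right inner_diff_right field_simps)
    then show "?T (S x) = x" by (simp add: S_def)
  qed
  \<comment> \<open>\<open>lborel_eqI\<close> identifies Lebesgue measure by its values on boxes, so
    the constant is first moved to the other measure and divided out afterwards.\<close>
  have "lborel = density (distr lborel borel ?T) (\<lambda>_. ennreal c)"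
  proof (rule lborel_eqI)
    fix l r :: "real^'n::_" assume lr: "\<And>b. b \<in> Basis \<Longrightarrow> l \<bullet> b \<le> r \<bullet> b"
    have vim: "?T -` box l r = S ` box l r" 
    proof safe
      fix x assume "?T x \<in> box l r"
      then show "x \<in> S ` box l r" 
        by (rule image_eqI[rotated]) (simp only: ST)
    qed (simp only: TS vimage_eq)
    have T: "?T -` box l r \<in> sets borel"
      by (rule measurable_sets_borel[of _ borel]) simp_all
    have fin: "S ` box l r \<in> lmeasurable" 
      by (rule measurable_linear_image[OF S]) simp
    have "emeasure lborel (?T -` box l r) = emeasure lebesgue (S ` box l r)"
      using T vim by simp
    also have "\<dots> = ennreal (measure lebesgue (S ` box l r))"
      using fin by (simp add: emeasure_eq_measure2)
    also have "measure lebesgue (S ` box l r) = (1 / c) * measure lborel (box l r)"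
      by (subst measure_linear_image) (use S in \<open>auto simp: detS\<close>)
    also have "ennreal \<dots> = ennreal (1 / c) * emeasure lborel (box l r)"
    proof -
      have "emeasure lborel (box l r) = ennreal (measure lborel (box l r))"
        by (rule emeasure_eq_ennreal_measure) (simp add: emeasure_lborel_box_eq)
      then show ?thesis
        using c by (simp only: ennreal_mult' zero_le_divide_1_iff less_imp_le)
    qed
    finally have *: "emeasure lborel (?T -` box l r) = ennreal (1 / c) * emeasure lborel (box l r)" .
    have "emeasure (density (distr lborel borel ?T) (\<lambda>_. ennreal c)) (box l r) = ennreal c * emeasure lborel (?T -` box l r)"
      by (subst emeasure_density_const, simp, subst emeasure_distr) simp_all
    also have "\<dots> = emeasure lborel (box l r)"
      unfolding * mult.assoc[symmetric] cc by simp
    finally show "emeasure (density (distr lborel borel ?T) (\<lambda>_. ennreal c)) (box l r) = ennreal (\<Prod>b\<in>Basis. (r - l) \<bullet> b)"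
      using emeasure_lborel_box[OF lr] by simp
  qed simp
  then have "density lborel (\<lambda>_. ennreal (1 / c)) = density (density (distr lborel borel ?T) (\<lambda>_. ennreal c)) (\<lambda>_. ennreal (1 / c))"
    by (rule arg_cong)
  also have "\<dots> = distr lborel borel ?T"
    by (subst density_density_eq) (simp_all add: density_1 cc)
  finally show ?thesis by (simp add: c_def)
qed

text \<open>A bijection of the coordinates pulls boxes back to boxes with the same side lengths, and
  the values on boxes determine Lebesgue measure.\<close>

lemma lborel_reindex:
  fixes h :: "'p::finite \<Rightarrow> 'n::finite"
  assumes "bij h"
  shows "distr lborel borel (\<lambda>y::real^'n. \<chi> i. y $ h i) = (lborel :: (real^'p) measure)"
proof -
  let ?r = "\<lambda>y::real^'n. (\<chi> i. y $ h i) :: real^'p"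
  have r: "?r \<in> borel_measurable borel"
    by (intro borel_measurable_continuous_onI continuous_intros)
  have box: "emeasure lborel (box l u) = ennreal (\<Prod>i\<in>UNIV. (u $ i - l $ i))"
    if "\<And>i. l $ i \<le> u $ i" for l u :: "real^'m::finite"
  proof -
    have "emeasure lborel (box l u) = ennreal (\<Prod>b\<in>Basis. (u - l) \<bullet> b)"
      by (rule emeasure_lborel_box) (use that in \<open>auto simp: Basis_vec_def inner_axis\<close>)
    also have "(\<Prod>b\<in>Basis. (u - l) \<bullet> b) = (\<Prod>i\<in>UNIV. (u $ i - l $ i))"
      unfolding Basis_vec_def
      by (subst prod.UNION_disjoint) (auto simp: inner_axis axis_eq_axis)
    finally show ?thesis .
  qed
  have "(lborel :: (real^'p) measure) = distr lborel borel ?r"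
  proof (rule lborel_eqI)
    fix l u :: "real^'p" assume lu: "\<And>b. b \<in> Basis \<Longrightarrow> l \<bullet> b \<le> u \<bullet> b"
    have lu': "l $ i \<le> u $ i" for i using lu[of "axis i 1"] by (simp add: inner_axis)
    have *: "?r -` box l u = box (\<chi> j. l $ inv h j) (\<chi> j. u $ inv h j)"
      using assms by (auto simp: mem_box_cart bij_is_surj surj_f_inv_f bij_is_inj)
         (metis assms bij_inv_eq_iff)+
    have "emeasure (distr lborel borel ?r) (box l u) = emeasure lborel (box (\<chi> j. l $ inv h j) (\<chi> j. u $ inv h j))"
      using r by (simp add: emeasure_distr *)
    also have "\<dots> = ennreal (\<Prod>j\<in>UNIV. (u $ inv h j - l $ inv h j))"
      by (subst box) (auto simp: lu')
    also have "(\<Prod>j\<in>UNIV. (u $ inv h j - l $ inv h j)) = (\<Prod>i\<in>UNIV. (u $ i - l $ i))"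
      by (rule prod.reindex_bij_betw[OF bij_imp_bij_inv[OF assms]])
    also have "ennreal \<dots> = emeasure lborel (box l u)"
      by (rule box[symmetric]) (rule lu')
    also have "\<dots> = ennreal (\<Prod>b\<in>Basis. (u - l) \<bullet> b)"
      by (rule emeasure_lborel_box) (rule lu)
    finally show "emeasure (distr lborel borel ?r) (box l u) = ennreal (\<Prod>b\<in>Basis. (u - l) \<bullet> b)" .
  qed simp
  then show ?thesis by (rule sym)
qed

text \<open>Reindexing is orthogonal: \<open>s\<close> is both inverse and adjoint to
  \<open>r\<close>. Hence \<open>r\<close> intertwines the update by \<open>u\<close>,
  \<open>w\<close> with the one by \<open>s u\<close>, \<open>s w\<close>, and the inner product in
  the constant is preserved.\<close>

lemma lborel_rank_one_update:
  fixes u w :: "real^'p"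
  assumes "1 + w \<bullet> u > 0"
  shows "distr lborel borel (\<lambda>x. x + (w \<bullet> x) *\<^sub>R u) = density lborel (\<lambda>_. ennreal (1 / (1 + w \<bullet> u)))"
proof -
  have "card (UNIV :: 'p wo_index set) = card (UNIV :: 'p set)" by (rule card_wo_index)
  then obtain h :: "'p \<Rightarrow> 'p wo_index" where h: "bij h"
    using finite_same_card_bij[of "UNIV :: 'p set" "UNIV :: 'p wo_index set"] by auto
  define r where "r = (\<lambda>y::real^'p wo_index. (\<chi> i. y $ h i) :: real^'p)"
  define s where "s = (\<lambda>x::real^'p. (\<chi> j. x $ inv h j) :: real^'p wo_index)"
  have r: "r \<in> borel_measurable borel"
    unfolding r_def by (intro borel_measurable_continuous_onI continuous_intros)
  have lb: "(lborel :: (real^'p) measure) = distr lborel borel r"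
    unfolding r_def by (rule lborel_reindex[OF h, symmetric])
  have inner: "s x \<bullet> y = x \<bullet> r y" for x y
    unfolding inner_vec_def s_def r_def vec_lambda_beta
    by (subst sum.reindex_bij_betw[OF h, symmetric]) (simp add: bij_is_inj[OF h])
  have rs: "r (s x) = x" for x
    by (simp add: r_def s_def bij_is_inj[OF h])
  have r_lin: "r (y + c *\<^sub>R z) = r y + c *\<^sub>R r z" for y z c
    by (simp add: r_def vec_eq_iff)
  let ?T = "\<lambda>x. x + (w \<bullet> x) *\<^sub>R u" and ?T' = "\<lambda>y. y + (s w \<bullet> y) *\<^sub>R s u"
  have T: "?T \<in> borel_measurable borel" and T': "?T' \<in> borel_measurable borel"
    by simp_all
  have "distr lborel borel ?T = distr (distr lborel borel r) borel ?T"
    by (subst lb) (rule refl)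
  also have "\<dots> = distr lborel borel (?T \<circ> r)"
    by (rule distr_distr) (use T r in auto)
  also have "?T \<circ> r = r \<circ> ?T'"
    by (simp add: fun_eq_iff r_lin inner rs)
  also have "distr lborel borel (r \<circ> ?T') = distr (distr lborel borel ?T') borel r"
    by (rule distr_distr[symmetric]) (use T' r in auto)
  also have "distr lborel borel ?T' = density lborel (\<lambda>_. ennreal (1 / (1 + w \<bullet> u)))"
    by (subst lborel_rank_one_update_wellorder) (use assms in \<open>simp_all add: inner rs\<close>)
  also have "distr \<dots> borel r = density (distr lborel borel r) (\<lambda>_. ennreal (1 / (1 + w \<bullet> u)))"
    by (rule density_distr[symmetric]) (use r in auto)
  also have "\<dots> = density lborel (\<lambda>_. ennreal (1 / (1 + w \<bullet> u)))"
    by (simp flip: lb)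
  finally show ?thesis .
qed

section \<open>Positive definite matrices\<close>

definition pos_def :: "real^'p^'p \<Rightarrow> bool"
  where "pos_def C \<longleftrightarrow> transpose C = C \<and> (\<forall>x. x \<noteq> 0 \<longrightarrow> 0 < x \<bullet> (C *v x))"

lemma inner_matrix_transpose:
  fixes A :: "real^'n^'m"
  shows "x \<bullet> (A *v y) = (transpose A *v x) \<bullet> y"
  by (metis dot_lmul_matrix transpose_matrix_vector)

lemma inner_symmetric_matrix:
  fixes C :: "real^'p^'p"
  assumes "transpose C = C"
  shows "x \<bullet> (C *v y) = y \<bullet> (C *v x)"
  by (metis assms inner_commute inner_matrix_transpose)

text \<open>The constant is the minimum of the form on the unit sphere, attained by compactness;
  homogeneity extends the bound to all vectors.\<close>

lemma pos_def_lower_bound: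
  assumes "pos_def C"
  obtains c where "c > 0" "\<And>x. c * (x \<bullet> x) \<le> x \<bullet> (C *v x)"
proof -
  have "\<exists>y\<in>sphere (0::real^'a) 1. \<forall>x\<in>sphere 0 1. y \<bullet> (C *v y) \<le> x \<bullet> (C *v x)"
  proof (rule continuous_attains_inf)
    have "axis undefined 1 \<in> sphere (0::real^'a) 1" by simp
    then show "sphere (0::real^'a) 1 \<noteq> {}" by blast
  qed (auto intro!: continuous_intros matrix_vector_mult_linear_continuous_on)
  then obtain y where y: "norm y = 1" "\<And>x. norm x = 1 \<Longrightarrow> y \<bullet> (C *v y) \<le> x \<bullet> (C *v x)"
    by auto
  show thesis
  proof
    show "0 < y \<bullet> (C *v y)" using assms y(1) by (metis norm_zero pos_def_def zero_neq_one)
    fix x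
    show "(y \<bullet> (C *v y)) * (x \<bullet> x) \<le> x \<bullet> (C *v x)"
    proof (cases "x = 0")
      case False
      define e where "e = (1 / norm x) *\<^sub>R x"
      have e: "norm e = 1" using False by (simp add: e_def)
      have x: "x = norm x *\<^sub>R e" using False by (simp add: e_def)
      have "x \<bullet> (C *v x) = (norm x)\<^sup>2 * (e \<bullet> (C *v e))"
        by (subst (1 2) x) (simp add: matrix_vector_mult_scaleR power2_eq_square)
      then show ?thesis
        using mult_left_mono[OF y(2)[OF e], of "(norm x)\<^sup>2"]
        by (simp add: dot_square_norm mult.commute)
    qed simp
  qed
qed

section \<open>Simultaneous diagonalization of two quadratic forms\<close>

lemma linear_coeff_zero_if_quadratic_nonpos:
  fixes a b :: real
  assumes "\<And>t. 2 * t * a + t\<^sup>2 * b \<le> 0"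
  shows "a = 0"
proof (rule ccontr)
  assume "a \<noteq> 0"
  \<comment> \<open>At t = a / s the expression equals (a / s)^2 (2 s + b), and this
    \<open>s\<close> is large enough to make the last factor positive.\<close>
  define s where "s = \<bar>b\<bar> + 1"
  have s: "s > 0" "2 * s + b > 0" by (auto simp: s_def)
  have "2 * (a / s) * a + (a / s)\<^sup>2 * b = (a / s)\<^sup>2 * (2 * s + b)"
    using s(1) by (simp add: power2_eq_square field_simps)
  moreover have "\<dots> > 0"
    using \<open>a \<noteq> 0\<close> s by simp
  ultimately show False using assms[of "a / s"] by simp
qed

text \<open>
  The next vector maximizes \<open>x \<bullet> D x\<close> over the \<open>C\<close>-unit vectors that are
  \<open>C\<close>-orthogonal to the previous ones.
\<close>

lemma simultaneous_diagonalization_aux: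
  fixes C D :: "real^'p^'p"
  assumes C: "pos_def C" and D: "transpose D = D"
  shows "\<exists>v. (\<forall>i\<in>F :: 'p set. \<forall>j\<in>F. v i \<bullet> (C *v v j) = (if i = j then 1 else 0))
     \<and> (\<forall>i\<in>F. \<forall>j\<in>F. i \<noteq> j \<longrightarrow> v i \<bullet> (D *v v j) = 0)
     \<and> (\<forall>x. (\<forall>i\<in>F. v i \<bullet> (C *v x) = 0) \<longrightarrow> (\<forall>i\<in>F. v i \<bullet> (D *v x) = 0))"
  (is "\<exists>v. ?P F v")
  using finite[of F]
proof (induction F rule: finite_induct)
  case (insert a F)
  then obtain v where v: "?P F v" by blast
  have symC: "x \<bullet> (C *v y) = y \<bullet> (C *v x)" for x y
    using C by (intro inner_symmetric_matrix) (simp add: pos_def_def)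
  have symD: "x \<bullet> (D *v y) = y \<bullet> (D *v x)" for x y
    using D by (rule inner_symmetric_matrix)
  define V where "V = {x. \<forall>i\<in>F. v i \<bullet> (C *v x) = 0}"
  have V_lin: "x + t *\<^sub>R y \<in> V" "t *\<^sub>R x \<in> V" if "x \<in> V" "y \<in> V" for x y t
    using that by (auto simp: V_def matrix_vector_right_distrib matrix_vector_mult_scaleR inner_add_right)
  \<comment> \<open>Fewer than CARD('p) vectors cannot span the space, so some nonzero vector is
    left over. It makes the constraint set of the maximization nonempty.\<close>
  have "dim (span ((\<lambda>i. C *v v i) ` F)) < DIM(real^'p)"
  proof -
    have "dim (span ((\<lambda>i. C *v v i) ` F)) \<le> card ((\<lambda>i. C *v v i) ` F)"
      by (simp add: dim_le_card')
    also have "\<dots> \<le> card F" by (rule card_image_le) simp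
    also have "\<dots> < CARD('p)"
      using insert.hyps by (intro psubset_card_mono) auto
    finally show ?thesis by simp
  qed
  then obtain z where z: "z \<noteq> 0" "\<And>y. y \<in> span ((\<lambda>i. C *v v i) ` F) \<Longrightarrow> orthogonal z y"
    using orthogonal_to_subspace_exists[of "(\<lambda>i. C *v v i) ` F"] by auto
  have zV: "z \<in> V"
  proof -
    have "v i \<bullet> (C *v z) = 0" if "i \<in> F" for i
      using z(2)[of "C *v v i"] that by (auto simp: orthogonal_def span_base symC[of "v i" z])
    then show ?thesis by (simp add: V_def)
  qed
  have unit: "(1 / sqrt (x \<bullet> (C *v x))) *\<^sub>R x \<in> {x \<in> V. x \<bullet> (C *v x) = 1}" if "x \<noteq> 0" "x \<in> V" for x
  proof -
    have "0 < x \<bullet> (C *v x)" using C that by (simp add: pos_def_def)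
    then show ?thesis using V_lin(2)[OF that(2) that(2)]
      by (simp add: matrix_vector_mult_scaleR field_simps)
  qed
  let ?K = "{x \<in> V. x \<bullet> (C *v x) = 1}"
  have "compact ?K"
  proof -
    obtain c where c: "c > 0" "\<And>x. c * (x \<bullet> x) \<le> x \<bullet> (C *v x)"
      using pos_def_lower_bound[OF C] by blast
    have "bounded ?K"
      unfolding bounded_iff
    proof (intro exI ballI)
      fix x assume "x \<in> ?K"
      then have "x \<bullet> x \<le> 1 / c" using c(2)[of x] c(1) by (simp add: field_simps)
      then show "norm x \<le> sqrt (1 / c)" unfolding norm_eq_sqrt_inner by (rule real_sqrt_le_mono)
    qed
    moreover have "closed ?K"
    proof -
      have "?K = (\<Inter>i\<in>F. {x. v i \<bullet> (C *v x) = 0}) \<inter> {x. x \<bullet> (C *v x) = 1}"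
        by (auto simp: V_def)
      also have "closed \<dots>"
        by (intro closed_Int closed_INT ballI closed_Collect_eq continuous_intros
           matrix_vector_mult_linear_continuous_on)
      finally show ?thesis .
    qed
    ultimately show ?thesis by (simp add: compact_eq_bounded_closed)
  qed
  then have "\<exists>m\<in>?K. \<forall>x\<in>?K. x \<bullet> (D *v x) \<le> m \<bullet> (D *v m)"
    by (rule continuous_attains_sup)
      (use unit[OF z(1) zV] in \<open>blast\<close>, intro continuous_intros matrix_vector_mult_linear_continuous_on)
  then obtain m where m: "m \<in> V" "m \<bullet> (C *v m) = 1"
      and max: "\<And>x. x \<in> ?K \<Longrightarrow> x \<bullet> (D *v x) \<le> m \<bullet> (D *v m)"
    by blast
  define d where "d = m \<bullet> (D *v m)"
  have max': "y \<bullet> (D *v y) \<le> d * (y \<bullet> (C *v y))" if "y \<in> V" for y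
  proof (cases "y = 0")
    case False
    have "0 < y \<bullet> (C *v y)" using C False by (simp add: pos_def_def)
    with max[OF unit[OF False that]] show ?thesis
      by (simp add: d_def matrix_vector_mult_scaleR field_simps)
  qed simp
  \<comment> \<open>On \<open>V\<close> the form of D - d C is at most 0, with equality at
    \<open>m\<close>, and moving from \<open>m\<close> along \<open>x\<close> stays in
    \<open>V\<close>. So the first-order term vanishes; its C part is zero by assumption.\<close>
  have stat: "m \<bullet> (D *v x) = 0" if "x \<in> V" "m \<bullet> (C *v x) = 0" for x
  proof (rule linear_coeff_zero_if_quadratic_nonpos)
    fix t
    have "d + 2 * t * (m \<bullet> (D *v x)) + t\<^sup>2 * (x \<bullet> (D *v x)) \<le> d * (1 + t\<^sup>2 * (x \<bullet> (C *v x)))"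
      using max'[OF V_lin(1)[OF m(1) that(1), of t]]
      by (simp add: matrix_vector_right_distrib matrix_vector_mult_scaleR inner_add_left inner_add_right
         symC[of x m] symD[of x m] that m d_def power2_eq_square algebra_simps)
    then show "2 * t * (m \<bullet> (D *v x)) + t\<^sup>2 * (x \<bullet> (D *v x) - d * (x \<bullet> (C *v x))) \<le> 0"
      by (simp add: algebra_simps)
  qed
  \<comment> \<open>As a member of \<open>V\<close>, \<open>m\<close> is C-orthogonal to the old
    vectors. The third conjunct of the induction hypothesis turns this into D-orthogonality, and
    \<open>stat\<close> renews that conjunct for \<open>m\<close>.\<close>
  have mF: "v i \<bullet> (C *v m) = 0" "m \<bullet> (C *v v i) = 0" "v i \<bullet> (D *v m) = 0" "m \<bullet> (D *v v i) = 0"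
    if "i \<in> F" for i
    using m(1) that v by (auto simp: V_def symC[of m "v i"] symD[of m "v i"])
  have "?P (insert a F) (v(a := m))"
  proof (intro conjI allI impI)
    fix x assume x: "\<forall>i\<in>insert a F. (v(a := m)) i \<bullet> (C *v x) = 0"
    then have "x \<in> V" "m \<bullet> (C *v x) = 0" using insert.hyps by (auto simp: V_def split: if_splits)
    then show "\<forall>i\<in>insert a F. (v(a := m)) i \<bullet> (D *v x) = 0"
      using stat v by (auto simp: V_def)
  qed (use insert.hyps v m mF in \<open>auto split: if_splits\<close>)
  then show ?case by blast
qed simp

lemma simultaneous_diagonalization:
  fixes C D :: "real^'p^'p"
  assumes "pos_def C" "transpose D = D"
  obtains G :: "real^'p^'p" and d :: "'p \<Rightarrow> real"
  where "transpose G ** C ** G = mat 1" "transpose G ** D ** G = (\<chi> i j. if i = j then d i else 0)"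
proof -
  obtain v where v: "\<And>i j :: 'p. v i \<bullet> (C *v v j) = (if i = j then 1 else 0)"
      "\<And>i j. i \<noteq> j \<Longrightarrow> v i \<bullet> (D *v v j) = 0"
    using simultaneous_diagonalization_aux[OF assms, of UNIV] by auto
  define G where "G = (\<chi> i j::'p. v j $ i)"
  have G: "(transpose G ** A ** G) $ i $ j = v i \<bullet> (A *v v j)" for A i j
    unfolding matrix_mul_assoc[symmetric]
    by (simp add: G_def matrix_matrix_mult_def matrix_vector_mult_def transpose_def inner_vec_def)
  show thesis
    by (rule that[of G "\<lambda>i. v i \<bullet> (D *v v i)"]) (auto simp: vec_eq_iff G v mat_def)
qed

section \<open>Comparing likelihoods\<close>

text \<open>
  The substitution \<open>b = (1 - \<epsilon>) / d\<close> turns the sum into one of terms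
  \<open>b - ln b - 1 \<ge> (sqrt b - 1)\<^sup>2\<close>.
\<close>

lemma log_deviation_small:
  fixes \<delta> :: real
  assumes "\<delta> > 0"
  shows "\<exists>\<epsilon>>0. \<epsilon> < 1 \<and> (\<forall>d :: 'p::finite \<Rightarrow> real. (\<forall>i. 0 < d i) \<longrightarrow>
      (\<Sum>i\<in>UNIV. (1 - \<epsilon>) / d i + ln (d i)) \<le> real CARD('p) * (1 + \<epsilon>) \<longrightarrow> (\<forall>i. \<bar>d i - 1\<bar> \<le> \<delta>))"
proof -
  define p where "p = real CARD('p)"
  \<comment> \<open>Under the square root stands the bound that the hypothesis gives for the sum of
    the terms b - ln b - 1. Since each term dominates (sqrt b - 1)^2, \<kappa> bounds every
    \<bar>sqrt b - 1\<bar>; it tends to 0 with \<open>e\<close>.\<close>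
  define \<kappa> where "\<kappa> e = sqrt (p * e - p * ln (1 - e))" for e
  have *: "((\<lambda>e. f e (\<kappa> e)) \<longlongrightarrow> f 0 0) (at_right 0)" if "isCont (\<lambda>x. f (fst x) (snd x)) (0, 0)" for f :: "real \<Rightarrow> real \<Rightarrow> real"
  proof -
    have "isCont \<kappa> 0" unfolding \<kappa>_def by (intro continuous_intros) auto
    then have "(\<kappa> \<longlongrightarrow> 0) (at_right 0)"
      using filterlim_at_split by (auto simp: isCont_def \<kappa>_def)
    then have "((\<lambda>e. (e, \<kappa> e)) \<longlongrightarrow> (0, 0)) (at_right 0)"
      by (intro tendsto_intros)
    from isCont_tendsto_compose[OF that this] show ?thesis by simp
  qed
  \<comment> \<open>As \<open>d i\<close> is (1 - e) / b, the bound by \<kappa> puts it between this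
    quotient and the next one. For small \<open>e\<close> both lie within \<delta> of 1.\<close>
  have "\<forall>\<^sub>F e in at_right 0. (1 - e) / (1 + \<kappa> e)\<^sup>2 > 1 - \<delta>"
    by (rule order_tendstoD(1)[OF *[of "\<lambda>e k. (1 - e) / (1 + k)\<^sup>2"]]) (use assms in \<open>auto intro!: continuous_intros\<close>)
  moreover have "\<forall>\<^sub>F e in at_right 0. (1 - e) / (1 - \<kappa> e)\<^sup>2 < 1 + \<delta>"
    by (rule order_tendstoD(2)[OF *[of "\<lambda>e k. (1 - e) / (1 - k)\<^sup>2"]]) (use assms in \<open>auto intro!: continuous_intros\<close>)
  moreover have "\<forall>\<^sub>F e in at_right 0. \<kappa> e < 1"
    by (rule order_tendstoD(2)[OF *[of "\<lambda>e k. k"]]) (auto intro!: continuous_intros)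
  moreover have "\<forall>\<^sub>F e in at_right (0::real). 0 < e \<and> e < 1"
    using eventually_at_right_real[of 0 1] by simp
  ultimately have "\<forall>\<^sub>F e in at_right 0. (1 - e) / (1 + \<kappa> e)\<^sup>2 > 1 - \<delta> \<and> (1 - e) / (1 - \<kappa> e)\<^sup>2 < 1 + \<delta> \<and> \<kappa> e < 1 \<and> 0 < e \<and> e < 1"
    by eventually_elim simp
  then obtain e where e: "(1 - e) / (1 + \<kappa> e)\<^sup>2 > 1 - \<delta>" "(1 - e) / (1 - \<kappa> e)\<^sup>2 < 1 + \<delta>"
      "\<kappa> e < 1" "0 < e" "e < 1"
    using eventually_happens[of _ "at_right (0::real)"] trivial_limit_at_right_real by blast
  show ?thesis
  proof (intro exI[of _ e] conjI allI impI e(4,5))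
    fix d :: "'p \<Rightarrow> real" and i
    assume "\<forall>i. 0 < d i" and sum: "(\<Sum>i\<in>UNIV. (1 - e) / d i + ln (d i)) \<le> real CARD('p) * (1 + e)"
    then have d: "0 < d i" for i by blast
    define b where "b i = (1 - e) / d i" for i
    have b: "b i > 0" for i using d[of i] e by (simp add: b_def)
    have d_eq: "d i = (1 - e) / b i" for i using d[of i] e by (simp add: b_def)
    \<comment> \<open>This is ln y \<le> y - 1 at y = sqrt b, doubled.\<close>
    have sq: "(sqrt (b i) - 1)\<^sup>2 \<le> b i - ln (b i) - 1" for i
    proof -
      have "ln (b i) = 2 * ln (sqrt (b i))" using b[of i] by (simp add: ln_sqrt)
      also have "\<dots> \<le> 2 * (sqrt (b i) - 1)" using ln_le_minus_one[of "sqrt (b i)"] b[of i] by simp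
      finally show ?thesis using b[of i] by (simp add: power2_diff)
    qed
    have "(\<Sum>i\<in>UNIV. b i - ln (b i) - 1) = (\<Sum>i\<in>UNIV. ((1 - e) / d i + ln (d i)) - (ln (1 - e) + 1))"
      using b e by (intro sum.cong) (auto simp: b_def ln_div d less_imp_neq[OF d, symmetric])
    also have "\<dots> \<le> p * e - p * ln (1 - e)"
      using sum by (simp add: sum_subtractf p_def algebra_simps)
    finally have S: "(\<Sum>i\<in>UNIV. b i - ln (b i) - 1) \<le> p * e - p * ln (1 - e)" .
    show "\<bar>d i - 1\<bar> \<le> \<delta>"
    proof -
      have "(sqrt (b i) - 1)\<^sup>2 \<le> (\<Sum>i\<in>UNIV. b i - ln (b i) - 1)"
        
        by (rule order_trans[OF sq], rule member_le_sum)
           (rule UNIV_I, rule order_trans[OF zero_le_power2 sq], rule finite)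
      with S have "\<bar>sqrt (b i) - 1\<bar> \<le> \<kappa> e"
        unfolding \<kappa>_def by (intro real_le_rsqrt) simp
      then have r: "1 - \<kappa> e \<le> sqrt (b i)" "sqrt (b i) \<le> 1 + \<kappa> e" "0 < 1 + \<kappa> e" by linarith+
      have "(1 - \<kappa> e)\<^sup>2 \<le> b i" "b i \<le> (1 + \<kappa> e)\<^sup>2"
        using power_mono[OF r(1), of 2] power_mono[OF r(2), of 2] e b[of i] by auto
      then have "(1 - e) / (1 + \<kappa> e)\<^sup>2 \<le> d i" "d i \<le> (1 - e) / (1 - \<kappa> e)\<^sup>2"
        unfolding d_eq using b[of i] e r(3) by (auto intro!: divide_left_mono mult_pos_pos zero_less_power)
      then show "\<bar>d i - 1\<bar> \<le> \<delta>" using e by linarith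
    qed
  qed
qed

text \<open>Diagonalizing C against itself gives a \<open>G\<close> with (det G)^2 det C =
  1.\<close>

lemma pos_def_det_pos:
  assumes "pos_def C"
  shows "det C > 0"
proof -
  obtain G and d where G: "transpose G ** C ** G = (mat 1 :: real^'a^'a)"
    using simultaneous_diagonalization[OF assms, of C] assms by (auto simp: pos_def_def)
  have "det (transpose G ** C ** G) = (det G)\<^sup>2 * det C"
    by (simp add: det_mul power2_eq_square)
  then have "(det G)\<^sup>2 * det C = 1" by (simp add: G)
  then show ?thesis by (metis zero_less_mult_pos zero_less_one zero_le_power2 mult_eq_0_iff zero_neq_one order_le_less)
qed

lemma pos_def_matrix_inv:
  fixes C :: "real^'p^'p"
  assumes "pos_def C"
  shows "C ** matrix_inv C = mat 1" "matrix_inv C ** C = mat 1"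
proof -
  have "\<exists>A'. C ** A' = mat 1 \<and> A' ** C = mat 1"
    using pos_def_det_pos[OF assms] invertible_det_nz[of C] by (auto simp: invertible_def)
  from someI_ex[OF this] show "C ** matrix_inv C = mat 1" "matrix_inv C ** C = mat 1"
    by (auto simp: matrix_inv_def)
qed

lemma prod_centered_normal_density:
  fixes C :: "real^'p^'p" and n :: nat
  assumes "pos_def C"
  shows "(\<Prod>m<n. centered_normal_density C (x m)) =
    exp (- ((\<Sum>m<n. x m \<bullet> (matrix_inv C *v x m)) + n * ln ((2 * pi) ^ CARD('p) * det C)) / 2)"
proof -
  have "centered_normal_density C y = exp (- (y \<bullet> (matrix_inv C *v y) + ln ((2 * pi) ^ CARD('p) * det C)) / 2)" for y
  proof -
    define D where "D = (2 * pi) ^ CARD('p) * det C"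
    have "D > 0" using pos_def_det_pos[OF assms] by (simp add: D_def)
    then have "sqrt D = exp (ln D / 2)" by (simp add: ln_sqrt[symmetric])
    then show ?thesis
      unfolding centered_normal_density_def D_def[symmetric]
      by (simp add: exp_diff[symmetric] minus_divide_left[symmetric] add_divide_distrib)
  qed
  then have "(\<Prod>m<n. centered_normal_density C (x m)) =
      exp (\<Sum>m<n. - (x m \<bullet> (matrix_inv C *v x m) + ln ((2 * pi) ^ CARD('p) * det C)) / 2)"
    by (subst exp_sum) simp_all
  also have "(\<Sum>m<n. - (x m \<bullet> (matrix_inv C *v x m) + L) / 2) =
      - ((\<Sum>m<n. x m \<bullet> (matrix_inv C *v x m)) + n * L) / 2" for L :: real
    by (simp only: sum_divide_distrib[symmetric] sum_negf sum.distrib sum_constant card_lessThan)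
  finally show ?thesis .
qed

text \<open>Everything follows from the substitution v = G z, where \<open>G\<close> is invertible
  because (det G)^2 det C = 1. The formula for the inverse says that it equals G diag(1/d) G^T, read
  through the columns of \<open>G\<close>.\<close>

lemma diagonalized_forms:
  fixes C D G :: "real^'p^'p"
  assumes C: "pos_def C" and D: "pos_def D"
    and GC: "transpose G ** C ** G = mat 1"
    and GD: "transpose G ** D ** G = (\<chi> i j. if i = j then d i else 0)"
  shows "d i > 0"
    and "det D = det C * (\<Prod>i\<in>UNIV. d i)"
    and "column i G \<bullet> (C *v column i G) = 1"
    and "x \<bullet> (matrix_inv D *v x) = (\<Sum>i\<in>UNIV. (column i G \<bullet> x)\<^sup>2 / d i)"
    and "\<exists>z. v \<bullet> (C *v v) = (\<Sum>i\<in>UNIV. (z $ i)\<^sup>2) \<and> v \<bullet> (D *v v) = (\<Sum>i\<in>UNIV. d i * (z $ i)\<^sup>2)"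
proof -
  have ent: "(transpose G ** A ** G) $ i $ j = column i G \<bullet> (A *v column j G)" for A i j
    unfolding matrix_mul_assoc[symmetric]
    by (simp add: column_def matrix_matrix_mult_def matrix_vector_mult_def transpose_def inner_vec_def)
  have CG: "column i G \<bullet> (C *v column i G) = 1" for i
    using ent[of C i i] by (simp add: GC mat_def)
  then show "column i G \<bullet> (C *v column i G) = 1" .
  have dpos: "d i > 0" for i
  proof -
    have "column i G \<noteq> 0" using CG[of i] by auto
    then show ?thesis using ent[of D i i] D by (simp add: GD pos_def_def)
  qed
  then show "d i > 0" .
  have detC: "(det G)\<^sup>2 * det C = 1"
    using arg_cong[OF GC, of det] by (simp add: det_mul power2_eq_square mult_ac)
  have "(det G)\<^sup>2 * det D = det (\<chi> i j. if i = j then d i else 0)"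
    using arg_cong[OF GD, of det] by (simp add: det_mul power2_eq_square mult_ac)
  also have "\<dots> = (\<Prod>i\<in>UNIV. d i)"
    by (subst det_diagonal) auto
  finally have "det C * (\<Prod>i\<in>UNIV. d i) = ((det G)\<^sup>2 * det C) * det D" by (simp add: mult_ac)
  then show "det D = det C * (\<Prod>i\<in>UNIV. d i)" using detC by simp
  have surj: "\<exists>z. y = G *v z" for y
  proof -
    have "det G \<noteq> 0" using detC by auto
    then obtain G' where "G ** G' = mat 1" using invertible_det_nz[of G] by (auto simp: invertible_def)
    then have "y = G *v (G' *v y)" by (simp add: matrix_vector_mul_assoc)
    then show ?thesis ..
  qed
  have form: "(G *v z) \<bullet> (A *v (G *v z)) = z \<bullet> ((transpose G ** A ** G) *v z)" for A z
    by (simp add: inner_matrix_transpose[of z "transpose G"] matrix_vector_mul_assoc[symmetric]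
      del: transpose_matrix_vector)
  have diag: "(\<chi> i j. if i = j then d i else 0) *v z = (\<chi> i. d i * z $ i)" for z :: "real^'p"
    by (simp add: vec_eq_iff matrix_vector_mult_def if_distrib[of "\<lambda>a. a * _"] cong: if_cong)
  have formD: "(G *v z) \<bullet> (D *v (G *v z)) = (\<Sum>i\<in>UNIV. d i * (z $ i)\<^sup>2)" for z
    unfolding form GD diag by (simp add: inner_vec_def power2_eq_square mult_ac)
  obtain z where z: "v = G *v z" using surj by blast
  have "v \<bullet> (C *v v) = (\<Sum>i\<in>UNIV. (z $ i)\<^sup>2)"
    unfolding z form GC by (simp add: inner_vec_def power2_eq_square)
  with formD[of z]
  show "\<exists>z. v \<bullet> (C *v v) = (\<Sum>i\<in>UNIV. (z $ i)\<^sup>2) \<and> v \<bullet> (D *v v) = (\<Sum>i\<in>UNIV. d i * (z $ i)\<^sup>2)"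
    unfolding z by blast
  \<comment> \<open>In these coordinates \<open>column i G \<bullet> x\<close> is
    \<open>d i * z $ i\<close>, so the form of the inverse at \<open>x\<close> becomes the form of D
    at \<open>G *v z\<close>.\<close>
  obtain z where z: "matrix_inv D *v x = G *v z" using surj by blast
  have x: "x = D *v (G *v z)"
    unfolding z[symmetric] by (simp add: matrix_vector_mul_assoc pos_def_matrix_inv[OF D])
  have col: "column i G \<bullet> x = d i * z $ i" for i
  proof -
    have "column i G \<bullet> x = (transpose G *v x) $ i"
      by (simp add: matrix_vector_mul_component transpose_def column_def del: transpose_matrix_vector)
    also have "transpose G *v x = (transpose G ** D ** G) *v z"
      by (simp add: x matrix_vector_mul_assoc[symmetric] del: transpose_matrix_vector)
    finally show ?thesis by (simp add: GD diag)
  qed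
  have "x \<bullet> (matrix_inv D *v x) = (G *v z) \<bullet> (D *v (G *v z))"
    unfolding z by (subst x) (rule inner_commute)
  also have "\<dots> = (\<Sum>i\<in>UNIV. (column i G \<bullet> x)\<^sup>2 / d i)"
    unfolding formD col using dpos by (intro sum.cong) (auto simp: power2_eq_square less_imp_neq[OF dpos, symmetric])
  finally show "x \<bullet> (matrix_inv D *v x) = (\<Sum>i\<in>UNIV. (column i G \<bullet> x)\<^sup>2 / d i)" .
qed

text \<open>The error is relative, so that the condition survives any linear change of coordinates.
  Both sides carry the factor \<open>n\<close> instead of dividing by it; for n = 0 the condition is
  trivially true.\<close>

definition second_moments_close :: "real \<Rightarrow> real^'p^'p \<Rightarrow> nat \<Rightarrow> (nat \<Rightarrow> real^'p) \<Rightarrow> bool"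
  where "second_moments_close \<epsilon> C n x \<longleftrightarrow>
    (\<forall>w. \<bar>(\<Sum>m<n. (w \<bullet> x m)\<^sup>2) - n * (w \<bullet> (C *v w))\<bar> \<le> \<epsilon> * (n * (w \<bullet> (C *v w))))"

text \<open>
  In coordinates that make \<open>C\<close> the identity and \<open>D\<close> diagonal with entries \<open>d i\<close>, comparing
  log-likelihoods gives \<open>\<Sum> (1 - \<epsilon>) / d i + ln (d i) \<le> p (1 + \<epsilon>)\<close>, whose left-hand side
  is close to its minimum \<open>p\<close> only for \<open>d\<close> close to \<open>1\<close>.
\<close>

lemma likelihood_comparison:
  fixes \<delta> :: real
  assumes "\<delta> > 0"
  shows "\<exists>\<epsilon>>0. \<forall>(C :: real^'p^'p) D n x v. pos_def C \<longrightarrow> pos_def D \<longrightarrow> n \<ge> 1 \<longrightarrow>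
      second_moments_close \<epsilon> C n x \<longrightarrow>
      (\<Prod>m<n. centered_normal_density C (x m)) \<le> (\<Prod>m<n. centered_normal_density D (x m)) \<longrightarrow>
      \<bar>v \<bullet> (D *v v) - v \<bullet> (C *v v)\<bar> \<le> \<delta> * (v \<bullet> (C *v v))"
proof -
  obtain \<epsilon> :: real where *: "0 < \<epsilon> \<and> \<epsilon> < 1 \<and> (\<forall>d :: 'p::finite \<Rightarrow> real. (\<forall>i. 0 < d i) \<longrightarrow>
      (\<Sum>i\<in>UNIV. (1 - \<epsilon>) / d i + ln (d i)) \<le> real CARD('p) * (1 + \<epsilon>) \<longrightarrow> (\<forall>i. \<bar>d i - 1\<bar> \<le> \<delta>))"
    using log_deviation_small[OF assms, where ?'p = 'p] ..
  note \<epsilon> = *[THEN conjunct1] *[THEN conjunct2, THEN conjunct1] *[THEN conjunct2, THEN conjunct2, rule_format]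
  show ?thesis
  proof (intro exI[of _ \<epsilon>] conjI allI impI \<epsilon>(1))
    fix C D :: "real^'p^'p" and n :: nat and x :: "nat \<Rightarrow> real^'p" and v
    assume C: "pos_def C" and D: "pos_def D" and n: "n \<ge> 1"
      and close: "second_moments_close \<epsilon> C n x"
      and le: "(\<Prod>m<n. centered_normal_density C (x m)) \<le> (\<Prod>m<n. centered_normal_density D (x m))"
    have D': "transpose D = D" using D by (simp add: pos_def_def)
    obtain G :: "real^'p^'p" and d :: "'p \<Rightarrow> real" where GC: "transpose G ** C ** G = mat 1"
        and GD: "transpose G ** D ** G = (\<chi> i j. if i = j then d i else 0)"
      by (rule simultaneous_diagonalization[OF C D'])
    note dg = diagonalized_forms[OF C D GC GD]
    \<comment> \<open>Taking D = C with all ratios 1 expresses the quadratic form of the inverse of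
      C in the same coordinates.\<close>
    have GC': "transpose G ** C ** G = (\<chi> i j. if i = j then 1 else 0)"
      unfolding GC by (simp add: mat_def)
    note cg = diagonalized_forms[OF C C GC GC']
    define Q where "Q i = (\<Sum>m<n. (column i G \<bullet> x m)\<^sup>2)" for i
    have QD: "(\<Sum>m<n. x m \<bullet> (matrix_inv D *v x m)) = (\<Sum>i\<in>UNIV. Q i / d i)"
      unfolding dg(4) Q_def by (subst sum.swap) (simp add: sum_divide_distrib)
    have QC: "(\<Sum>m<n. x m \<bullet> (matrix_inv C *v x m)) = (\<Sum>i\<in>UNIV. Q i)"
      unfolding cg(4) Q_def by (subst sum.swap) simp
    have Ql: "(1 - \<epsilon>) * n \<le> Q i" and Qu: "Q i \<le> (1 + \<epsilon>) * n" for i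
      using close[unfolded second_moments_close_def, rule_format, of "column i G"] dg(3)[of i]
      by (auto simp: Q_def abs_le_iff algebra_simps)
    have lnD: "ln ((2 * pi) ^ CARD('p) * det D) = ln ((2 * pi) ^ CARD('p) * det C) + (\<Sum>i\<in>UNIV. ln (d i))"
    proof -
      have "ln ((2 * pi) ^ CARD('p) * det D) = ln (((2 * pi) ^ CARD('p) * det C) * (\<Prod>i\<in>UNIV. d i))"
        by (simp add: dg(2) mult.assoc)
      also have "\<dots> = ln ((2 * pi) ^ CARD('p) * det C) + ln (\<Prod>i\<in>UNIV. d i)"
        using pos_def_det_pos[OF C] dg(1) by (intro ln_mult_pos) (auto intro: prod_pos)
      also have "ln (\<Prod>i\<in>UNIV. d i) = (\<Sum>i\<in>UNIV. ln (d i))"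
        using dg(1) by (intro ln_prod) (auto simp: less_imp_neq[OF dg(1), symmetric])
      finally show ?thesis .
    qed
    \<comment> \<open>The lower bound on \<open>Q\<close> is used on the side of D, the upper bound
      on the side of C. The normalizing constant and the determinant of C occur on both sides and
      cancel.\<close>
    have "n * (\<Sum>i\<in>UNIV. (1 - \<epsilon>) / d i + ln (d i)) = (\<Sum>i\<in>UNIV. (1 - \<epsilon>) * n / d i) + n * (\<Sum>i\<in>UNIV. ln (d i))"
      by (simp add: sum.distrib distrib_left sum_distrib_left mult_ac)
    also have "\<dots> \<le> (\<Sum>i\<in>UNIV. Q i / d i) + n * (\<Sum>i\<in>UNIV. ln (d i))"
      using dg(1) Ql by (intro add_right_mono sum_mono divide_right_mono) (auto intro: less_imp_le)
    also have "\<dots> \<le> (\<Sum>i\<in>UNIV. Q i)"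
      using le unfolding prod_centered_normal_density[OF C] prod_centered_normal_density[OF D] QC QD lnD
      by (simp add: distrib_left)
    also have "\<dots> \<le> (\<Sum>i\<in>(UNIV :: 'p set). (1 + \<epsilon>) * n)"
      by (intro sum_mono Qu)
    also have "\<dots> = n * (real CARD('p) * (1 + \<epsilon>))" by simp
    finally have "(\<Sum>i\<in>UNIV. (1 - \<epsilon>) / d i + ln (d i)) \<le> real CARD('p) * (1 + \<epsilon>)"
      using n by simp
    then have d: "\<bar>d i - 1\<bar> \<le> \<delta>" for i
      by (rule \<epsilon>(3)[OF dg(1)])
    obtain z where z: "v \<bullet> (C *v v) = (\<Sum>i\<in>UNIV. (z $ i)\<^sup>2)" "v \<bullet> (D *v v) = (\<Sum>i\<in>UNIV. d i * (z $ i)\<^sup>2)"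
      using dg(5)[of v] by blast
    have "\<bar>v \<bullet> (D *v v) - v \<bullet> (C *v v)\<bar> = \<bar>\<Sum>i\<in>UNIV. (d i - 1) * (z $ i)\<^sup>2\<bar>"
      by (simp add: z sum_subtractf left_diff_distrib)
    also have "\<dots> \<le> (\<Sum>i\<in>UNIV. \<bar>(d i - 1) * (z $ i)\<^sup>2\<bar>)" by (rule sum_abs)
    also have "\<dots> \<le> (\<Sum>i\<in>UNIV. \<delta> * (z $ i)\<^sup>2)"
      using d by (intro sum_mono) (simp add: abs_mult mult_right_mono)
    finally show "\<bar>v \<bullet> (D *v v) - v \<bullet> (C *v v)\<bar> \<le> \<delta> * (v \<bullet> (C *v v))"
      by (simp add: z sum_distrib_left)
  qed
qed

section \<open>Second moments of normal samples\<close>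

lemma centered_normal_density_measurable [measurable]: "centered_normal_density S \<in> borel_measurable borel"
  unfolding centered_normal_density_def
  by (intro borel_measurable_divide borel_measurable_const borel_measurable_continuous_onI
      continuous_intros matrix_vector_mult_linear_continuous_on) auto

text \<open>
  The rank-one map \<open>x \<mapsto> x + t (w \<bullet> x) C w\<close> multiplies the normal density by
  \<open>exp (- (t + t\<^sup>2 s / 2) (w \<bullet> x)\<^sup>2)\<close>, so a linear change of variables computes the Laplace transform of
  \<open>(w \<bullet> x)\<^sup>2\<close> without evaluating any Gaussian integral.
\<close>

lemma (in prob_space) centered_normal_square_laplace:
  fixes C :: "real^'p^'p" and X :: "'a \<Rightarrow> real^'p"
  assumes C: "pos_def C"
    and X: "distributed M lborel X (\<lambda>x. ennreal (centered_normal_density C x))"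
    and t: "1 + t * (w \<bullet> (C *v w)) > 0"
  shows "(\<integral>\<^sup>+\<omega>. ennreal (exp (- (t + t\<^sup>2 * (w \<bullet> (C *v w)) / 2) * (w \<bullet> X \<omega>)\<^sup>2)) \<partial>M)
    = ennreal (1 / (1 + t * (w \<bullet> (C *v w))))"
proof -
  define s where "s = w \<bullet> (C *v w)"
  define P where "P = matrix_inv C"
  define f where "f = centered_normal_density C"
  define T where "T x = x + (w \<bullet> x) *\<^sub>R (t *\<^sub>R (C *v w))" for x
  have f_m [measurable]: "f \<in> borel_measurable borel" by (simp add: f_def)
  have T_m [measurable]: "T \<in> borel_measurable borel" unfolding T_def by simp
  have PC: "P *v (C *v y) = y" "C *v (P *v y) = y" for y
    by (simp_all add: P_def matrix_vector_mul_assoc pos_def_matrix_inv[OF C])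
  have CP: "(C *v w) \<bullet> (P *v y) = w \<bullet> y" for y
    using C inner_symmetric_matrix[of C w "P *v y"] by (simp add: pos_def_def PC inner_commute)
  have "T x \<bullet> (P *v T x) = x \<bullet> (P *v x) + 2 * (t + t\<^sup>2 * s / 2) * (w \<bullet> x)\<^sup>2" for x
    by (simp add: T_def matrix_vector_right_distrib matrix_vector_mult_scaleR PC CP inner_add_left inner_add_right
      s_def[symmetric] inner_commute[of x w] inner_commute[of "C *v w" w] power2_eq_square algebra_simps)
  then have fT: "f (T x) = f x * exp (- (t + t\<^sup>2 * s / 2) * (w \<bullet> x)\<^sup>2)" for x
    unfolding f_def centered_normal_density_def P_def[symmetric]
    by (simp add: exp_add[symmetric] field_simps)
  have f0: "f x \<ge> 0" for x
    using pos_def_det_pos[OF C] by (simp add: f_def centered_normal_density_def)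
  \<comment> \<open>The total mass 1 of the density is read off from the fact that \<open>X\<close>
    has this density.\<close>
  have "(\<integral>\<^sup>+x. ennreal (f x) \<partial>lborel) = (\<integral>\<^sup>+x. ennreal (f x) * 1 \<partial>lborel)" by simp
  also have "\<dots> = (\<integral>\<^sup>+\<omega>. 1 \<partial>M)"
    using distributed_nn_integral[OF X, of "\<lambda>_. 1"] by (simp add: f_def)
  finally have one: "(\<integral>\<^sup>+x. ennreal (f x) \<partial>lborel) = 1" by (simp add: emeasure_space_1)
  have "(\<integral>\<^sup>+\<omega>. ennreal (exp (- (t + t\<^sup>2 * s / 2) * (w \<bullet> X \<omega>)\<^sup>2)) \<partial>M)
      = (\<integral>\<^sup>+x. ennreal (f x) * ennreal (exp (- (t + t\<^sup>2 * s / 2) * (w \<bullet> x)\<^sup>2)) \<partial>lborel)"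
    unfolding f_def by (rule distributed_nn_integral[OF X, symmetric]) measurable
  also have "\<dots> = (\<integral>\<^sup>+x. ennreal (f (T x)) \<partial>lborel)"
    by (simp add: fT ennreal_mult' f0)
  also have "\<dots> = (\<integral>\<^sup>+x. ennreal (f x) \<partial>distr lborel borel T)"
    by (subst nn_integral_distr) (use T_m f_m in simp_all)
  also have "distr lborel borel T = density lborel (\<lambda>_. ennreal (1 / (1 + t * s)))"
    unfolding T_def using lborel_rank_one_update[of w "t *\<^sub>R (C *v w)"] t by (simp add: s_def)
  also have "(\<integral>\<^sup>+x. ennreal (f x) \<partial>\<dots>) = ennreal (1 / (1 + t * s))"
    by (subst nn_integral_density) (simp_all add: nn_integral_cmult one)
  finally show ?thesis by (simp add: s_def)
qed

text \<open>With c = t + t^2 s / 2 one has 1 + 2 c s = (1 + t s)^2, so \<rho> is the expectation of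
  exp (c (a - Y^2)) for a centered normal Y of variance s. It equals 1 at t = 0 and has derivative a
  - s there, so it drops below 1 for small t of the right sign, which is also the sign of c.\<close>

lemma square_laplace_rate:
  fixes a s :: real
  assumes s: "s \<ge> 0"
  defines "\<rho> \<equiv> \<lambda>t. exp ((t + t\<^sup>2 * s / 2) * a) / (1 + t * s)"
  shows "a < s \<Longrightarrow> \<exists>t. 1 + t * s > 0 \<and> t + t\<^sup>2 * s / 2 > 0 \<and> \<rho> t < 1"
    and "s < a \<Longrightarrow> \<exists>t. 1 + t * s > 0 \<and> t + t\<^sup>2 * s / 2 < 0 \<and> \<rho> t < 1"
proof -
  have D: "DERIV \<rho> 0 :> a - s"
    unfolding \<rho>_def by (auto intro!: derivative_eq_intros)
  have \<rho>0: "\<rho> 0 = 1" by (simp add: \<rho>_def)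
  show "\<exists>t. 1 + t * s > 0 \<and> t + t\<^sup>2 * s / 2 > 0 \<and> \<rho> t < 1" if "a < s"
  proof -
    from DERIV_neg_dec_right[OF D] that obtain d where d: "d > 0" "\<And>h. 0 < h \<Longrightarrow> h < d \<Longrightarrow> \<rho> h < 1"
      by (auto simp: \<rho>0)
    have "1 + (d / 2) * s > 0" "d / 2 + (d / 2)\<^sup>2 * s / 2 > 0"
      using d(1) s by (auto intro!: add_pos_nonneg)
    then show ?thesis using d(1) d(2)[of "d / 2"] by (intro exI[of _ "d / 2"]) auto
  qed
  show "\<exists>t. 1 + t * s > 0 \<and> t + t\<^sup>2 * s / 2 < 0 \<and> \<rho> t < 1" if "s < a"
  proof -
    from DERIV_pos_inc_left[OF D] that obtain d where d: "d > 0" "\<And>h. 0 < h \<Longrightarrow> h < d \<Longrightarrow> \<rho> (- h) < 1"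
      by (auto simp: \<rho>0)
    \<comment> \<open>The second bound gives h s < 1. This keeps 1 - h s positive and makes the
      exponent coefficient at - h negative.\<close>
    define h where "h = min (d / 2) (1 / (s + 1))"
    have h: "0 < h" "h < d" "h \<le> 1 / (s + 1)" using d(1) s by (auto simp: h_def)
    have "h * s < 1" using h s by (simp add: field_simps) 
    moreover have "- h + (- h)\<^sup>2 * s / 2 = - (h * (1 - h * s / 2))"
      by (simp add: power2_eq_square algebra_simps)
    ultimately show ?thesis
      using h d(2)[of h] by (intro exI[of _ "- h"]) auto
  qed
qed

text \<open>Keeping the coefficient c = t + t^2 s / 2, where s is the variance of the projection, on
  both sides lets one argument bound the sums from below when c > 0 and from above when c < 0. By
  Markov and independence the n-th failure probability is at most the n-th power of the left side of
  \<open>rate\<close>, which is summable.\<close>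

lemma (in prob_space) square_chernoff_AE:
  fixes C :: "real^'p^'p" and X :: "nat \<Rightarrow> 'a \<Rightarrow> real^'p" and a :: real
  assumes C: "pos_def C"
    and indep: "indep_vars (\<lambda>_. borel) X UNIV"
    and X: "\<And>i. distributed M lborel (X i) (\<lambda>x. ennreal (centered_normal_density C x))"
    and t: "1 + t * (w \<bullet> (C *v w)) > 0"
    and rate: "exp ((t + t\<^sup>2 * (w \<bullet> (C *v w)) / 2) * a) / (1 + t * (w \<bullet> (C *v w))) < 1"
  shows "AE \<omega> in M. \<forall>\<^sub>F n in sequentially.
    (t + t\<^sup>2 * (w \<bullet> (C *v w)) / 2) * (n * a) < (t + t\<^sup>2 * (w \<bullet> (C *v w)) / 2) * (\<Sum>m<n. (w \<bullet> X m \<omega>)\<^sup>2)"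
proof -
  define c where "c = t + t\<^sup>2 * (w \<bullet> (C *v w)) / 2"
  define r where "r = 1 / (1 + t * (w \<bullet> (C *v w)))"
  have r: "r > 0" using t by (simp add: r_def)
  define \<rho> where "\<rho> = exp (c * a) * r"
  have \<rho>: "0 \<le> \<rho>" "\<rho> < 1" using rate r by (auto simp: \<rho>_def c_def r_def)
  have X_m [measurable]: "X i \<in> borel_measurable M" for i
    using distributed_measurable[OF X, of i] by simp
  define A where "A n = {\<omega> \<in> space M. c * (\<Sum>m<n. (w \<bullet> X m \<omega>)\<^sup>2) \<le> c * (n * a)}" for n :: nat
  have A_m [measurable]: "A n \<in> sets M" for n
    unfolding A_def by measurable
  have A_le: "emeasure M (A n) \<le> ennreal (\<rho> ^ n)" for n
  proof -
    let ?Y = "\<lambda>i \<omega>. ennreal (exp (- c * (w \<bullet> X i \<omega>)\<^sup>2))"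
    have "A n = {\<omega> \<in> space M. 1 \<le> ennreal (exp (c * (n * a))) * (\<Prod>i<n. ?Y i \<omega>)}"
    proof -
      have "(\<Prod>i<n. ?Y i \<omega>) = ennreal (exp (\<Sum>i<n. - c * (w \<bullet> X i \<omega>)\<^sup>2))" for \<omega>
        unfolding exp_sum[OF finite_lessThan] by (rule prod_ennreal) simp
      then have "ennreal (exp (c * (n * a))) * (\<Prod>i<n. ?Y i \<omega>)
          = ennreal (exp (c * (n * a)) * exp (\<Sum>i<n. - c * (w \<bullet> X i \<omega>)\<^sup>2))" for \<omega>
        by (simp add: ennreal_mult')
      also have "\<dots> \<omega> = ennreal (exp (c * (n * a) - c * (\<Sum>i<n. (w \<bullet> X i \<omega>)\<^sup>2)))" for \<omega>
        by (simp only: exp_add[symmetric] sum_distrib_left[symmetric]) simp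
      finally have "ennreal (exp (c * (n * a))) * (\<Prod>i<n. ?Y i \<omega>)
          = ennreal (exp (c * (n * a) - c * (\<Sum>i<n. (w \<bullet> X i \<omega>)\<^sup>2)))" for \<omega> .
      then show ?thesis by (simp add: A_def)
    qed
    also have "emeasure M \<dots> \<le> ennreal (exp (c * (n * a))) * (\<integral>\<^sup>+\<omega>. (\<Prod>i<n. ?Y i \<omega>) \<partial>M)"
      using nn_integral_Markov_inequality[of "\<lambda>\<omega>. \<Prod>i<n. ?Y i \<omega>" "space M" M "ennreal (exp (c * (n * a)))"]
      by (simp cong: nn_integral_cong)
    also have "(\<integral>\<^sup>+\<omega>. (\<Prod>i<n. ?Y i \<omega>) \<partial>M) = (\<Prod>i<n. \<integral>\<^sup>+\<omega>. ?Y i \<omega> \<partial>M)"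
    proof (rule indep_vars_nn_integral)
      show "indep_vars (\<lambda>_. borel) ?Y {..<n}"
        by (rule indep_vars_compose2[OF indep_vars_subset[OF indep]]) auto
    qed auto
    also have "\<dots> = ennreal (r ^ n)"
      using centered_normal_square_laplace[OF C X t] r by (simp add: c_def r_def ennreal_power)
    also have "ennreal (exp (c * (n * a))) * ennreal (r ^ n) = ennreal (\<rho> ^ n)"
      using r by (simp add: \<rho>_def power_mult_distrib exp_of_nat_mult[symmetric] ennreal_mult[symmetric] mult_ac)
    finally show ?thesis .
  qed
  have "summable (\<lambda>n. measure M (A n))"
  proof (rule summable_comparison_test')
    show "summable (\<lambda>n. \<rho> ^ n)" using \<rho> by (intro summable_geometric) auto
    show "norm (measure M (A n)) \<le> \<rho> ^ n" for n
      using A_le[of n] \<rho> by (simp add: emeasure_eq_measure)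
  qed
  then have "AE \<omega> in M. \<forall>\<^sub>F n in sequentially. \<omega> \<in> space M - A n"
    by (intro borel_cantelli_AE1) (auto simp: emeasure_eq_measure)
  then show ?thesis
  proof eventually_elim
    case (elim \<omega>)
    then show ?case
      by eventually_elim (auto simp: A_def c_def)
  qed
qed

lemma (in prob_space) square_strong_law:
  fixes C :: "real^'p^'p" and X :: "nat \<Rightarrow> 'a \<Rightarrow> real^'p"
  assumes C: "pos_def C"
    and indep: "indep_vars (\<lambda>_. borel) X UNIV"
    and X: "\<And>i. distributed M lborel (X i) (\<lambda>x. ennreal (centered_normal_density C x))"
  shows "AE \<omega> in M. (\<lambda>n. (\<Sum>m<n. (w \<bullet> X m \<omega>)\<^sup>2) / n) \<longlonglongrightarrow> w \<bullet> (C *v w)"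
proof -
  define s where "s = w \<bullet> (C *v w)"
  have s: "s \<ge> 0" using C by (cases "w = 0") (auto simp: s_def pos_def_def less_imp_le)
  have lower: "AE \<omega> in M. \<forall>\<^sub>F n in sequentially. n * a < (\<Sum>m<n. (w \<bullet> X m \<omega>)\<^sup>2)" if "a < s" for a :: real
  proof -
    obtain t where "1 + t * s > 0" "t + t\<^sup>2 * s / 2 > 0" "exp ((t + t\<^sup>2 * s / 2) * a) / (1 + t * s) < 1"
      using square_laplace_rate(1)[OF s \<open>a < s\<close>] by blast
    then show ?thesis using square_chernoff_AE[OF C indep X, of t w a] by (simp add: s_def)
  qed
  have upper: "AE \<omega> in M. \<forall>\<^sub>F n in sequentially. (\<Sum>m<n. (w \<bullet> X m \<omega>)\<^sup>2) < n * a" if "s < a" for a :: real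
  proof -
    obtain t where "1 + t * s > 0" "t + t\<^sup>2 * s / 2 < 0" "exp ((t + t\<^sup>2 * s / 2) * a) / (1 + t * s) < 1"
      using square_laplace_rate(2)[OF s \<open>s < a\<close>] by blast
    then show ?thesis using square_chernoff_AE[OF C indep X, of t w a]
      by (simp add: s_def mult_less_cancel_left_neg)
  qed
  \<comment> \<open>Countably many thresholds determine the limit, so their exceptional null sets
    can be united.\<close>
  have "AE \<omega> in M. \<forall>k. \<forall>\<^sub>F n in sequentially. n * (s - 1 / Suc k) < (\<Sum>m<n. (w \<bullet> X m \<omega>)\<^sup>2)"
    unfolding AE_all_countable by (intro allI lower) simp
  moreover have "AE \<omega> in M. \<forall>k. \<forall>\<^sub>F n in sequentially. (\<Sum>m<n. (w \<bullet> X m \<omega>)\<^sup>2) < n * (s + 1 / Suc k)"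
    unfolding AE_all_countable by (intro allI upper) simp
  ultimately show ?thesis
  proof eventually_elim
    case (elim \<omega>)
    show ?case unfolding s_def[symmetric]
    proof (rule tendstoI)
      fix e :: real assume "e > 0"
      then obtain k where k: "1 / real (Suc k) < e" using nat_approx_posE by blast
      from elim(1)[rule_format, of k] elim(2)[rule_format, of k] eventually_gt_at_top[of 0]
      show "\<forall>\<^sub>F n in sequentially. dist ((\<Sum>m<n. (w \<bullet> X m \<omega>)\<^sup>2) / n) s < e"
      proof eventually_elim
        case (elim n)
        then have "s - 1 / Suc k < (\<Sum>m<n. (w \<bullet> X m \<omega>)\<^sup>2) / n" "(\<Sum>m<n. (w \<bullet> X m \<omega>)\<^sup>2) / n < s + 1 / Suc k"
          by (simp_all add: less_divide_eq divide_less_eq mult.commute)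
        then show ?case using k by (simp add: dist_real_def abs_less_iff)
      qed
    qed
  qed
qed

text \<open>By polarization the directions e_i and e_i + e_j determine every entry of the sample
  second moment matrix. Entrywise convergence then controls the form in all directions at
  once.\<close>

lemma eventually_second_moments_close:
  fixes C :: "real^'p^'p" and x :: "nat \<Rightarrow> real^'p"
  assumes C: "pos_def C" and \<epsilon>: "\<epsilon> > 0"
    and lim1: "\<And>i. (\<lambda>n. (\<Sum>m<n. (axis i 1 \<bullet> x m)\<^sup>2) / n) \<longlonglongrightarrow> axis i 1 \<bullet> (C *v axis i 1)"
    and lim2: "\<And>i j. (\<lambda>n. (\<Sum>m<n. ((axis i 1 + axis j 1) \<bullet> x m)\<^sup>2) / n)
      \<longlonglongrightarrow> (axis i 1 + axis j 1) \<bullet> (C *v (axis i 1 + axis j 1))"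
  shows "\<forall>\<^sub>F n in sequentially. second_moments_close \<epsilon> C n x"
proof -
  obtain c where c: "c > 0" "\<And>w. c * (w \<bullet> w) \<le> w \<bullet> (C *v w)"
    using pos_def_lower_bound[OF C] by blast
  define S where "S n i j = (\<Sum>m<n. x m $ i * x m $ j) / n" for n i j
  have entry: "axis i 1 \<bullet> (C *v axis j 1) = C $ i $ j" for i j
    by (simp add: inner_axis' matrix_vector_mul_component inner_axis)
  have "(\<lambda>n. S n i j) \<longlonglongrightarrow> C $ i $ j" for i j
  proof -
    have symC: "C $ j $ i = C $ i $ j"
      using C by (simp add: pos_def_def transpose_def vec_eq_iff)
    have "S n i j = ((\<Sum>m<n. ((axis i 1 + axis j 1) \<bullet> x m)\<^sup>2) / n
        - (\<Sum>m<n. (axis i 1 \<bullet> x m)\<^sup>2) / n - (\<Sum>m<n. (axis j 1 \<bullet> x m)\<^sup>2) / n) / 2" for n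
      by (simp add: S_def inner_add_left inner_axis' power2_sum sum.distrib sum_distrib_left[symmetric]
         diff_divide_distrib add_divide_distrib mult.assoc)
    moreover have "C $ i $ j = ((axis i 1 + axis j 1) \<bullet> (C *v (axis i 1 + axis j 1))
        - axis i 1 \<bullet> (C *v axis i 1) - axis j 1 \<bullet> (C *v axis j 1)) / 2"
      by (simp add: inner_add_left inner_add_right matrix_vector_right_distrib entry symC)
    ultimately show ?thesis
      by (simp only:) (intro tendsto_intros lim1 lim2, simp)
  qed
  then have "(\<lambda>n. \<Sum>i\<in>UNIV. \<Sum>j\<in>UNIV. \<bar>S n i j - C $ i $ j\<bar>) \<longlonglongrightarrow> (\<Sum>i\<in>(UNIV::'p set). \<Sum>j\<in>(UNIV::'p set). \<bar>C $ i $ j - C $ i $ j\<bar>)"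
    by (intro tendsto_intros)
  \<comment> \<open>The entrywise error contributes at most this bound times w \<bullet> w; the
    factor \<open>c\<close> turns that into an error relative to the form of C.\<close>
  then have "\<forall>\<^sub>F n in sequentially. (\<Sum>i\<in>UNIV. \<Sum>j\<in>UNIV. \<bar>S n i j - C $ i $ j\<bar>) < \<epsilon> * c"
    by (rule order_tendstoD(2)) (use \<epsilon> c in simp)
  with eventually_gt_at_top[of 0] show ?thesis
  proof eventually_elim
    case (elim n)
    show ?case unfolding second_moments_close_def
    proof
      fix w :: "real^'p"
      have ww: "\<bar>w $ i * w $ j\<bar> \<le> w \<bullet> w" for i j
        using mult_mono[OF component_le_norm_cart[of w i] component_le_norm_cart[of w j]]
        by (simp add: abs_mult dot_square_norm power2_eq_square)
      have "(\<Sum>m<n. (w \<bullet> x m)\<^sup>2) = (\<Sum>m<n. \<Sum>i\<in>UNIV. \<Sum>j\<in>UNIV. w $ i * w $ j * (x m $ i * x m $ j))"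
        by (simp add: inner_vec_def power2_eq_square sum_product mult_ac)
      also have "\<dots> = n * (\<Sum>i\<in>UNIV. \<Sum>j\<in>UNIV. w $ i * w $ j * S n i j)"
      proof -
        have "(\<Sum>m<n. \<Sum>i\<in>UNIV. \<Sum>j\<in>UNIV. w $ i * w $ j * (x m $ i * x m $ j))
          = (\<Sum>i\<in>UNIV. \<Sum>j\<in>UNIV. \<Sum>m<n. w $ i * w $ j * (x m $ i * x m $ j))"
          by (subst sum.swap) (intro sum.cong refl sum.swap)
        also have "\<dots> = (\<Sum>i\<in>UNIV. \<Sum>j\<in>UNIV. n * (w $ i * w $ j * S n i j))"
          using elim(1) by (simp add: S_def sum_distrib_left[symmetric])
        finally show ?thesis by (simp add: sum_distrib_left)
      qed
      finally have Q: "(\<Sum>m<n. (w \<bullet> x m)\<^sup>2) = n * (\<Sum>i\<in>UNIV. \<Sum>j\<in>UNIV. w $ i * w $ j * S n i j)" .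
      have Cw: "w \<bullet> (C *v w) = (\<Sum>i\<in>UNIV. \<Sum>j\<in>UNIV. w $ i * w $ j * C $ i $ j)"
        by (simp add: inner_vec_def matrix_vector_mult_def sum_distrib_left mult_ac)
      have "\<bar>(\<Sum>i\<in>UNIV. \<Sum>j\<in>UNIV. w $ i * w $ j * S n i j) - w \<bullet> (C *v w)\<bar>
          = \<bar>\<Sum>i\<in>UNIV. \<Sum>j\<in>UNIV. w $ i * w $ j * (S n i j - C $ i $ j)\<bar>"
        by (simp add: Cw sum_subtractf right_diff_distrib)
      also have "\<dots> \<le> (\<Sum>i\<in>UNIV. \<Sum>j\<in>UNIV. \<bar>w $ i * w $ j * (S n i j - C $ i $ j)\<bar>)"
        by (rule order_trans[OF sum_abs]) (intro sum_mono sum_abs)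
      also have "\<dots> \<le> (\<Sum>i\<in>UNIV. \<Sum>j\<in>UNIV. (w \<bullet> w) * \<bar>S n i j - C $ i $ j\<bar>)"
        unfolding abs_mult[of "_ * _"] by (intro sum_mono mult_right_mono ww) auto
      also have "\<dots> = (w \<bullet> w) * (\<Sum>i\<in>UNIV. \<Sum>j\<in>UNIV. \<bar>S n i j - C $ i $ j\<bar>)"
        by (simp add: sum_distrib_left)
      also have "\<dots> \<le> (w \<bullet> w) * (\<epsilon> * c)"
        using elim(2) by (intro mult_left_mono) auto
      also have "\<dots> \<le> \<epsilon> * (w \<bullet> (C *v w))"
        using mult_left_mono[OF c(2)[of w], of \<epsilon>] \<epsilon> by (simp add: mult_ac)
      finally have "n * \<bar>(\<Sum>i\<in>UNIV. \<Sum>j\<in>UNIV. w $ i * w $ j * S n i j) - w \<bullet> (C *v w)\<bar> \<le> n * (\<epsilon> * (w \<bullet> (C *v w)))"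
        by (intro mult_left_mono) auto
      then show "\<bar>(\<Sum>m<n. (w \<bullet> x m)\<^sup>2) - n * (w \<bullet> (C *v w))\<bar> \<le> \<epsilon> * (n * (w \<bullet> (C *v w)))"
        unfolding Q right_diff_distrib[symmetric] abs_mult by (simp add: mult_ac)
    qed
  qed
qed

text \<open>The limits along finitely many directions do not involve \<epsilon>, so one null set
  serves all tolerances.\<close>

lemma (in prob_space) AE_eventually_second_moments_close:
  fixes C :: "real^'p^'p" and X :: "nat \<Rightarrow> 'a \<Rightarrow> real^'p"
  assumes C: "pos_def C"
    and indep: "indep_vars (\<lambda>_. borel) X UNIV"
    and X: "\<And>i. distributed M lborel (X i) (\<lambda>x. ennreal (centered_normal_density C x))"
  shows "AE \<omega> in M. \<forall>\<epsilon>>0. \<forall>\<^sub>F n in sequentially. second_moments_close \<epsilon> C n (\<lambda>i. X i \<omega>)"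
proof -
  note law = square_strong_law[OF assms]
  have "AE \<omega> in M. \<forall>i. (\<lambda>n. (\<Sum>m<n. (axis i 1 \<bullet> X m \<omega>)\<^sup>2) / n) \<longlonglongrightarrow> axis i 1 \<bullet> (C *v axis i 1)"
    unfolding AE_all_countable by (intro allI law)
  moreover have "AE \<omega> in M. \<forall>i j. (\<lambda>n. (\<Sum>m<n. ((axis i 1 + axis j 1) \<bullet> X m \<omega>)\<^sup>2) / n)
      \<longlonglongrightarrow> (axis i 1 + axis j 1) \<bullet> (C *v (axis i 1 + axis j 1))"
    unfolding AE_all_countable by (intro allI law)
  ultimately show ?thesis
    by eventually_elim (intro allI impI eventually_second_moments_close[OF C], auto)
qed

section \<open>Maximum likelihood in the PPCA model\<close>

lemma ppca_cov_form:
  "v \<bullet> (ppca_cov \<theta> *v v) = (norm (transpose (fst \<theta>) *v v))\<^sup>2 + snd \<theta> * (v \<bullet> v)"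
proof -
  have "v \<bullet> (fst \<theta> *v (transpose (fst \<theta>) *v v)) = (transpose (fst \<theta>) *v v) \<bullet> (transpose (fst \<theta>) *v v)"
    by (rule inner_matrix_transpose)
  then show ?thesis
    by (simp add: ppca_cov_def matrix_vector_mult_add_rdistrib matrix_vector_mul_assoc[symmetric]
      scaleR_matrix_vector_assoc[symmetric] inner_add_right power2_norm_eq_inner del: transpose_matrix_vector)
qed

lemma pos_def_ppca_cov:
  assumes "\<theta> \<in> ppca_params"
  shows "pos_def (ppca_cov \<theta>)"
proof -
  have s: "snd \<theta> > 0" using assms by (auto simp: ppca_params_def)
  have "transpose (ppca_cov \<theta>) = ppca_cov \<theta>"
    by (simp add: ppca_cov_def transpose_def vec_eq_iff matrix_matrix_mult_def mat_def mult.commute)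
  moreover have "0 < v \<bullet> (ppca_cov \<theta> *v v)" if "v \<noteq> 0" for v
    unfolding ppca_cov_form using s that by (intro add_nonneg_pos) auto
  ultimately show ?thesis by (simp add: pos_def_def)
qed

lemma continuous_on_ppca_cov: "continuous_on S ppca_cov"
proof -
  have eq: "ppca_cov = (\<lambda>\<theta>. \<chi> i j. (\<Sum>k\<in>UNIV. fst \<theta> $ i $ k * fst \<theta> $ j $ k) + snd \<theta> * mat 1 $ i $ j)"
    by (simp add: fun_eq_iff ppca_cov_def vec_eq_iff matrix_matrix_mult_def transpose_def)
  show ?thesis unfolding eq by (intro continuous_intros)
qed

lemma continuous_on_det:
  fixes F :: "'a::topological_space \<Rightarrow> real^'n^'n"
  assumes "\<And>i j. continuous_on S (\<lambda>s. F s $ i $ j)"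
  shows "continuous_on S (\<lambda>s. det (F s))"
  unfolding det_def by (intro continuous_intros assms)

text \<open>Cramer's rule writes the inverse applied to \<open>x\<close> as a quotient of
  determinants, which are polynomials in the entries.\<close>

lemma continuous_on_centered_normal_density:
  "continuous_on {C. pos_def C} (\<lambda>C. centered_normal_density C (x :: real^'p))"
proof -
  have inv: "matrix_inv C *v x = (\<chi> k. det (\<chi> i j. if j = k then x $ i else C $ i $ j) / det C)"
    if "pos_def C" for C
  proof -
    have "C *v (matrix_inv C *v x) = x"
      by (simp add: matrix_vector_mul_assoc pos_def_matrix_inv[OF that])
    moreover have "det C \<noteq> 0" using pos_def_det_pos[OF that] by simp
    ultimately show ?thesis using cramer by blast
  qed
  have entry: "continuous_on {C. pos_def C} (\<lambda>C. (\<chi> i j. if j = k then x $ i else C $ i $ j) $ i $ j)" for i j k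
    by (cases "j = k") (auto intro!: continuous_intros)
  have "continuous_on {C. pos_def C} (\<lambda>C. exp (- (x \<bullet> (\<chi> k. det (\<chi> i j. if j = k then x $ i else C $ i $ j) / det C)) / 2)
      / sqrt ((2 * pi) ^ CARD('p) * det C))"
    by (intro continuous_intros continuous_on_det entry) (auto dest: pos_def_det_pos)
  then show ?thesis
    by (rule continuous_on_eq) (simp add: centered_normal_density_def inv)
qed

lemma continuous_on_ppca_likelihood: "continuous_on ppca_params (ppca_likelihood n x)"
proof -
  have "continuous_on ppca_params (\<lambda>\<theta>. centered_normal_density (ppca_cov \<theta>) (x i))" for i
    by (rule continuous_on_compose2[OF continuous_on_centered_normal_density continuous_on_ppca_cov])
      (auto intro: pos_def_ppca_cov)
  then show ?thesis
    unfolding ppca_likelihood_def ppca_density_def by (intro continuous_on_prod)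
qed

lemma quadratic_form_upper_bound:
  fixes C :: "real^'p^'p"
  obtains B where "\<And>v. v \<bullet> (C *v v) \<le> B * (v \<bullet> v)"
proof
  fix v
  have "v \<bullet> (C *v v) \<le> norm v * norm (C *v v)" by (rule norm_cauchy_schwarz)
  also have "\<dots> \<le> norm v * (onorm ((*v) C) * norm v)"
    by (intro mult_left_mono onorm) auto
  finally show "v \<bullet> (C *v v) \<le> onorm ((*v) C) * (v \<bullet> v)"
    by (simp add: dot_square_norm power2_eq_square mult_ac)
qed

text \<open>The columns of \<open>W\<close> span at most CARD('q) dimensions. Along a vector
  orthogonal to all of them the covariance form reduces to the variance term, which isolates the
  variance.\<close>

lemma transpose_kernel_nontrivial:
  fixes W :: "real^'q^'p"
  assumes "CARD('q) < CARD('p)"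
  obtains v where "v \<noteq> 0" "transpose W *v v = 0"
proof -
  have range: "columns W = range (\<lambda>i. column i W)"
    by (auto simp: columns_def)
  then have "dim (span (columns W)) \<le> card (columns W)"
    by (simp add: dim_le_card')
  also have "card (columns W) \<le> CARD('q)"
    unfolding range by (rule card_image_le) simp
  finally have "dim (span (columns W)) < DIM(real^'p)" using assms by simp
  then obtain v where v: "v \<noteq> 0" "\<And>y. y \<in> span (columns W) \<Longrightarrow> orthogonal v y"
    using orthogonal_to_subspace_exists[of "columns W"] by auto
  have "column j W \<bullet> v = 0" for j
    using v(2)[OF span_base, of "column j W"] by (simp add: range orthogonal_def inner_commute)
  then have "transpose W *v v = 0"
    by (simp add: vec_eq_iff matrix_vector_mul_component transpose_def column_def del: transpose_matrix_vector)
  with v(1) show thesis by (rule that)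
qed

text \<open>
  Covariances whose form is comparable to a fixed one come from a compact set of parameters; that the
  variance stays away from \<open>0\<close> uses \<open>CARD('q) < CARD('p)\<close>.
\<close>

lemma ppca_params_comparable_compact:
  fixes C :: "real^'p^'p"
  assumes pq: "CARD('q) < CARD('p)" and C: "pos_def C"
  shows "\<exists>K :: ((real^'q^'p) \<times> real) set. compact K \<and> K \<subseteq> ppca_params \<and>
    (\<forall>\<theta>\<in>ppca_params. (\<forall>v. \<bar>v \<bullet> (ppca_cov \<theta> *v v) - v \<bullet> (C *v v)\<bar> \<le> 1 / 2 * (v \<bullet> (C *v v))) \<longrightarrow> \<theta> \<in> K)"
proof -
  obtain c where c: "c > 0" "\<And>v. c * (v \<bullet> v) \<le> v \<bullet> (C *v v)"
    using pos_def_lower_bound[OF C] by blast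
  obtain B where B: "\<And>v. v \<bullet> (C *v v) \<le> B * (v \<bullet> v)"
    using quadratic_form_upper_bound by blast
  \<comment> \<open>Comparability with factor 1 / 2 keeps the form of \<theta> between c / 2 and 3 B
    / 2 times v \<bullet> v. Coordinate vectors then bound the rows of W, and a kernel vector of its
    transpose bounds the variance.\<close>
  define K where "K = cball (0 :: real^'q^'p) (\<Sum>i\<in>(UNIV :: 'p set). sqrt (3 / 2 * B)) \<times> {c / 2..3 / 2 * B}"
  show ?thesis
  proof (intro exI[of _ K] conjI ballI impI)
    show "compact K" unfolding K_def by (intro compact_Times compact_cball compact_Icc)
    show "K \<subseteq> ppca_params" using c(1) by (auto simp: K_def ppca_params_def)
    fix \<theta> :: "(real^'q^'p) \<times> real"
    assume \<theta>: "\<theta> \<in> ppca_params"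
      and cmp: "\<forall>v. \<bar>v \<bullet> (ppca_cov \<theta> *v v) - v \<bullet> (C *v v)\<bar> \<le> 1 / 2 * (v \<bullet> (C *v v))"
    obtain W s where Ws: "\<theta> = (W, s)" by (cases \<theta>)
    have s: "s > 0" using \<theta> by (simp add: Ws ppca_params_def)
    have up: "(norm (transpose W *v v))\<^sup>2 + s * (v \<bullet> v) \<le> 3 / 2 * B * (v \<bullet> v)"
      and lo: "c / 2 * (v \<bullet> v) \<le> (norm (transpose W *v v))\<^sup>2 + s * (v \<bullet> v)" for v
    proof -
      have "\<bar>(norm (transpose W *v v))\<^sup>2 + s * (v \<bullet> v) - v \<bullet> (C *v v)\<bar> \<le> 1 / 2 * (v \<bullet> (C *v v))"
        using cmp[rule_format, of v] by (simp only: ppca_cov_form Ws fst_conv snd_conv)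
      then show "(norm (transpose W *v v))\<^sup>2 + s * (v \<bullet> v) \<le> 3 / 2 * B * (v \<bullet> v)"
          "c / 2 * (v \<bullet> v) \<le> (norm (transpose W *v v))\<^sup>2 + s * (v \<bullet> v)"
        using B[of v] c(2)[of v] by linarith+
    qed
    have row: "norm (W $ i) \<le> sqrt (3 / 2 * B)" for i
    proof -
      have "transpose W *v axis i 1 = W $ i"
        by (simp add: vec_eq_iff matrix_vector_mul_component inner_axis transpose_def del: transpose_matrix_vector)
      then have "(norm (W $ i))\<^sup>2 \<le> 3 / 2 * B" using up[of "axis i 1"] s by (simp add: inner_axis)
      then show ?thesis by (rule real_le_rsqrt)
    qed
    have "norm W \<le> (\<Sum>i\<in>UNIV. norm (W $ i))"
      unfolding norm_vec_def by (rule L2_set_le_sum) simp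
    also have "\<dots> \<le> (\<Sum>i\<in>(UNIV :: 'p set). sqrt (3 / 2 * B))" by (intro sum_mono row)
    finally have W: "norm W \<le> (\<Sum>i\<in>(UNIV :: 'p set). sqrt (3 / 2 * B))" .
    obtain v where v: "v \<noteq> 0" "transpose W *v v = 0" by (rule transpose_kernel_nontrivial[OF pq])
    have "c / 2 * (v \<bullet> v) \<le> s * (v \<bullet> v)" "s * (v \<bullet> v) \<le> 3 / 2 * B * (v \<bullet> v)"
      using lo[of v] up[of v] by (simp_all only: v(2)) simp_all
    then have "c / 2 \<le> s" "s \<le> 3 / 2 * B"
      using v(1) by (auto simp only: mult_le_cancel_right inner_gt_zero_iff)
    with W show "\<theta> \<in> K" by (simp add: K_def Ws)
  qed
qed

text \<open>Every parameter at least as likely as \<open>\<theta>\<^sub>0\<close>, including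
  \<open>\<theta>\<^sub>0\<close> itself, lies in a compact set. A maximum over that set is
  therefore global.\<close>

lemma ppca_likelihood_maximizer_exists:
  fixes \<theta>\<^sub>0 :: "(real^'q^'p) \<times> real"
  assumes pq: "CARD('q) < CARD('p)" and \<theta>\<^sub>0: "\<theta>\<^sub>0 \<in> ppca_params"
    and cmp: "\<And>(\<theta> :: (real^'q^'p) \<times> real) v. \<theta> \<in> ppca_params \<Longrightarrow> ppca_likelihood n x \<theta>\<^sub>0 \<le> ppca_likelihood n x \<theta> \<Longrightarrow>
      \<bar>v \<bullet> (ppca_cov \<theta> *v v) - v \<bullet> (ppca_cov \<theta>\<^sub>0 *v v)\<bar> \<le> 1 / 2 * (v \<bullet> (ppca_cov \<theta>\<^sub>0 *v v))"
  shows "\<exists>\<theta> :: (real^'q^'p) \<times> real. is_arg_max (ppca_likelihood n x) (\<lambda>\<theta>. \<theta> \<in> ppca_params) \<theta>"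
proof -
  obtain K :: "((real^'q^'p) \<times> real) set" where K: "compact K" "K \<subseteq> ppca_params"
    and K_mem: "\<forall>\<theta>\<in>ppca_params. (\<forall>v. \<bar>v \<bullet> (ppca_cov \<theta> *v v) - v \<bullet> (ppca_cov \<theta>\<^sub>0 *v v)\<bar>
      \<le> 1 / 2 * (v \<bullet> (ppca_cov \<theta>\<^sub>0 *v v))) \<longrightarrow> \<theta> \<in> K"
    using ppca_params_comparable_compact[OF pq pos_def_ppca_cov[OF \<theta>\<^sub>0]] by (elim exE conjE)
  have K_mem': "\<theta> \<in> K" if "\<theta> \<in> ppca_params" "ppca_likelihood n x \<theta>\<^sub>0 \<le> ppca_likelihood n x \<theta>" for \<theta>
    using K_mem[rule_format, OF that(1)] cmp[OF that] by blast
  have \<theta>\<^sub>0K: "\<theta>\<^sub>0 \<in> K" by (rule K_mem'[OF \<theta>\<^sub>0 order_refl])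
  have "\<exists>m\<in>K. \<forall>\<theta>\<in>K. ppca_likelihood n x \<theta> \<le> ppca_likelihood n x m"
    using \<theta>\<^sub>0K by (intro continuous_attains_sup K continuous_on_subset[OF continuous_on_ppca_likelihood]) auto
  then obtain m where m: "m \<in> K" "\<And>\<theta>. \<theta> \<in> K \<Longrightarrow> ppca_likelihood n x \<theta> \<le> ppca_likelihood n x m"
    by blast
  have "ppca_likelihood n x \<theta> \<le> ppca_likelihood n x m" if "\<theta> \<in> ppca_params"
    for \<theta> :: "(real^'q^'p) \<times> real"
  proof (cases "ppca_likelihood n x \<theta>\<^sub>0 \<le> ppca_likelihood n x \<theta>")
    case True
    show ?thesis by (rule m(2)[OF K_mem'[OF that True]])
  next
    case False
    then show ?thesis using m(2)[OF \<theta>\<^sub>0K] by linarith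
  qed
  then have "is_arg_max (ppca_likelihood n x) (\<lambda>\<theta>. \<theta> \<in> ppca_params) m"
    using m(1) K(2) by (auto simp: is_arg_max_linorder)
  then show ?thesis ..
qed

section \<open>From deterministic comparison to almost sure convergence\<close>

lemma tendsto_symmetric_matrix:
  fixes A :: "'b \<Rightarrow> real^'p^'p"
  assumes A: "\<forall>\<^sub>F n in F. transpose (A n) = A n" and C: "transpose C = C"
    and lim: "\<And>v. ((\<lambda>n. v \<bullet> (A n *v v)) \<longlongrightarrow> v \<bullet> (C *v v)) F"
  shows "(A \<longlongrightarrow> C) F"
proof (intro vec_tendstoI)
  fix i j :: 'p
  \<comment> \<open>Polarization recovers the entries of a symmetric matrix from its quadratic
    form.\<close>
  have polar: "D $ i $ j = ((axis i 1 + axis j 1) \<bullet> (D *v (axis i 1 + axis j 1))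
      - axis i 1 \<bullet> (D *v axis i 1) - axis j 1 \<bullet> (D *v axis j 1)) / 2" if "transpose D = D" for D :: "real^'p^'p"
  proof -
    have "axis a 1 \<bullet> (D *v axis b 1) = D $ a $ b" for a b
      by (simp add: inner_axis' matrix_vector_mul_component inner_axis)
    moreover have "D $ j $ i = D $ i $ j"
      using that by (auto simp: transpose_def vec_eq_iff)
    ultimately show ?thesis
      by (simp add: inner_add_left inner_add_right matrix_vector_right_distrib)
  qed
  have "((\<lambda>n. ((axis i 1 + axis j 1) \<bullet> (A n *v (axis i 1 + axis j 1))
      - axis i 1 \<bullet> (A n *v axis i 1) - axis j 1 \<bullet> (A n *v axis j 1)) / 2) \<longlongrightarrow> C $ i $ j) F"
    unfolding polar[OF C] by (intro tendsto_intros lim) simp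
  then show "((\<lambda>n. A n $ i $ j) \<longlongrightarrow> C $ i $ j) F"
    by (rule Lim_transform_eventually) (use A polar in \<open>auto elim!: eventually_mono\<close>)
qed

text \<open>With tolerances 1 / (k + 1), convergence to a fixed point becomes a countable
  combination of measurable conditions.\<close>

lemma sets_Collect_LIMSEQ:
  fixes f :: "nat \<Rightarrow> 'a \<Rightarrow> 'b::{metric_space, second_countable_topology}"
  assumes [measurable]: "\<And>n. f n \<in> borel_measurable M"
  shows "{x \<in> space M. (\<lambda>n. f n x) \<longlonglongrightarrow> c} \<in> sets M"
proof -
  have "(X \<longlonglongrightarrow> c) \<longleftrightarrow> (\<forall>k. \<exists>N. \<forall>n\<ge>N. dist (X n) c < 1 / real (Suc k))" for X :: "nat \<Rightarrow> 'b"
  proof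
    assume "\<forall>k. \<exists>N. \<forall>n\<ge>N. dist (X n) c < 1 / real (Suc k)"
    then show "X \<longlonglongrightarrow> c"
      by (intro metric_LIMSEQ_I) (meson less_trans nat_approx_posE)
  qed (auto simp: lim_sequentially)
  then show ?thesis by simp
qed

text \<open>It passes from the full sequence to its restriction to the first \<open>n\<close> terms,
  which is what the estimator receives.\<close>

lemma second_moments_close_cong:
  assumes "\<And>m. m < n \<Longrightarrow> x m = y m"
  shows "second_moments_close \<epsilon> C n x \<longleftrightarrow> second_moments_close \<epsilon> C n y"
proof -
  have "(\<Sum>m<n. (w \<bullet> x m)\<^sup>2) = (\<Sum>m<n. (w \<bullet> y m)\<^sup>2)" for w
    using assms by (intro sum.cong) auto
  then show ?thesis by (simp add: second_moments_close_def)
qed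

lemma ppca_mle_covariance_tendsto:
  fixes \<theta>\<^sub>0 :: "(real^'q^'p) \<times> real" and x :: "nat \<Rightarrow> real^'p"
    and T :: "nat \<Rightarrow> (nat \<Rightarrow> real^'p) \<Rightarrow> (real^'q^'p) \<times> real"
  assumes pq: "CARD('q) < CARD('p)" and \<theta>\<^sub>0: "\<theta>\<^sub>0 \<in> ppca_params"
    and mle: "\<And>n. n \<ge> 1 \<Longrightarrow> ppca_mle n (T n)"
    and close: "\<And>\<epsilon>. \<epsilon> > 0 \<Longrightarrow> \<forall>\<^sub>F n in sequentially. second_moments_close \<epsilon> (ppca_cov \<theta>\<^sub>0) n x"
  shows "(\<lambda>n. ppca_cov (T n (\<lambda>i\<in>{..<n}. x i))) \<longlonglongrightarrow> ppca_cov \<theta>\<^sub>0"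
proof -
  define C where "C = ppca_cov \<theta>\<^sub>0"
  define y where "y n = (\<lambda>i\<in>{..<n}. x i)" for n
  have C: "pos_def C" unfolding C_def by (rule pos_def_ppca_cov[OF \<theta>\<^sub>0])
  have y: "y n \<in> space (Pi\<^sub>M {..<n} (\<lambda>_. borel))" for n
    by (auto simp: y_def space_PiM)
  have T_params: "T n (y n) \<in> ppca_params" if "n \<ge> 1" for n
    using mle[OF that] y[of n] by (auto simp: ppca_mle_def)
  have comparison: "\<exists>\<epsilon>>0. \<forall>n (\<theta> :: (real^'q^'p) \<times> real) v. n \<ge> 1 \<longrightarrow> second_moments_close \<epsilon> C n x \<longrightarrow> \<theta> \<in> ppca_params \<longrightarrow>
      ppca_likelihood n (y n) \<theta>\<^sub>0 \<le> ppca_likelihood n (y n) \<theta> \<longrightarrow>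
      \<bar>v \<bullet> (ppca_cov \<theta> *v v) - v \<bullet> (C *v v)\<bar> \<le> \<delta> * (v \<bullet> (C *v v))"
    if \<delta>: "\<delta> > 0" for \<delta> :: real
  proof -
    have close_y: "second_moments_close \<epsilon> C n x \<longleftrightarrow> second_moments_close \<epsilon> C n (y n)" for \<epsilon> n
      by (rule second_moments_close_cong) (simp add: y_def)
    obtain \<epsilon> where "\<epsilon> > 0 \<and> (\<forall>(C :: real^'p^'p) D n x v. pos_def C \<longrightarrow> pos_def D \<longrightarrow> n \<ge> 1 \<longrightarrow>
      second_moments_close \<epsilon> C n x \<longrightarrow>
      (\<Prod>m<n. centered_normal_density C (x m)) \<le> (\<Prod>m<n. centered_normal_density D (x m)) \<longrightarrow>
      \<bar>v \<bullet> (D *v v) - v \<bullet> (C *v v)\<bar> \<le> \<delta> * (v \<bullet> (C *v v)))"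
      using likelihood_comparison[OF \<delta>] ..
    note \<epsilon> = this[THEN conjunct1] this[THEN conjunct2, rule_format]
    show ?thesis
      by (intro exI[of _ \<epsilon>] conjI allI impI \<epsilon>(1), rule \<epsilon>(2)[OF C pos_def_ppca_cov])
        (auto simp: close_y[unfolded C_def, symmetric] ppca_likelihood_def ppca_density_def C_def)
  qed
  \<comment> \<open>The fixed tolerance 1 / 2 serves only to obtain a maximizer; convergence uses
    arbitrarily small \<delta> below.\<close>
  obtain \<epsilon>1 where \<epsilon>1: "\<epsilon>1 > 0" "\<And>n (\<theta> :: (real^'q^'p) \<times> real) v. n \<ge> 1 \<Longrightarrow> second_moments_close \<epsilon>1 C n x \<Longrightarrow> \<theta> \<in> ppca_params \<Longrightarrow>
      ppca_likelihood n (y n) \<theta>\<^sub>0 \<le> ppca_likelihood n (y n) \<theta> \<Longrightarrow>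
      \<bar>v \<bullet> (ppca_cov \<theta> *v v) - v \<bullet> (C *v v)\<bar> \<le> 1 / 2 * (v \<bullet> (C *v v))"
    using comparison[of "1 / 2"] by auto
  have arg_max: "ppca_likelihood n (y n) \<theta>\<^sub>0 \<le> ppca_likelihood n (y n) (T n (y n))"
    if n: "n \<ge> 1" "second_moments_close \<epsilon>1 C n x" for n
  proof -
    have "\<exists>\<theta> :: (real^'q^'p) \<times> real. is_arg_max (ppca_likelihood n (y n)) (\<lambda>\<theta>. \<theta> \<in> ppca_params) \<theta>"
      by (rule ppca_likelihood_maximizer_exists[OF pq \<theta>\<^sub>0]) (rule \<epsilon>1(2)[OF n, unfolded C_def])
    then have "is_arg_max (ppca_likelihood n (y n)) (\<lambda>\<theta>. \<theta> \<in> ppca_params) (T n (y n))"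
      using mle[OF n(1)] y[of n] by (auto simp: ppca_mle_def)
    then show ?thesis using \<theta>\<^sub>0 unfolding is_arg_max_linorder by blast
  qed
  have "(\<lambda>n. ppca_cov (T n (y n))) \<longlonglongrightarrow> C"
  proof (rule tendsto_symmetric_matrix)
    \<comment> \<open>Only n \<ge> 1 is covered: nothing is assumed about \<open>T 0\<close>, so its
      variance need not be positive.\<close>
    show "\<forall>\<^sub>F n in sequentially. transpose (ppca_cov (T n (y n))) = ppca_cov (T n (y n))"
      using eventually_ge_at_top[of 1]
      by eventually_elim (use pos_def_ppca_cov[OF T_params] in \<open>auto simp: pos_def_def\<close>)
    show "transpose C = C" using C by (simp add: pos_def_def)
    fix v
    show "(\<lambda>n. v \<bullet> (ppca_cov (T n (y n)) *v v)) \<longlonglongrightarrow> v \<bullet> (C *v v)"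
    proof (rule tendstoI)
      fix e :: real assume e: "e > 0"
      define b where "b = v \<bullet> (C *v v)"
      have b: "b \<ge> 0" using C by (cases "v = 0") (auto simp: b_def pos_def_def less_imp_le)
      \<comment> \<open>The added 1 avoids division by zero when v = 0 and makes \<delta> * b < e
        strict.\<close>
      define \<delta> where "\<delta> = e / (b + 1)"
      have \<delta>: "\<delta> > 0" "\<delta> * b < e" using e b by (auto simp: \<delta>_def field_simps)
      obtain \<epsilon> where \<epsilon>: "\<epsilon> > 0" "\<And>n (\<theta> :: (real^'q^'p) \<times> real) v. n \<ge> 1 \<Longrightarrow> second_moments_close \<epsilon> C n x \<Longrightarrow> \<theta> \<in> ppca_params \<Longrightarrow>
          ppca_likelihood n (y n) \<theta>\<^sub>0 \<le> ppca_likelihood n (y n) \<theta> \<Longrightarrow>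
          \<bar>v \<bullet> (ppca_cov \<theta> *v v) - v \<bullet> (C *v v)\<bar> \<le> \<delta> * (v \<bullet> (C *v v))"
        using comparison[OF \<delta>(1)] by auto
      from close[folded C_def, OF \<epsilon>1(1)] close[folded C_def, OF \<epsilon>(1)] eventually_ge_at_top[of 1]
      show "\<forall>\<^sub>F n in sequentially. dist (v \<bullet> (ppca_cov (T n (y n)) *v v)) (v \<bullet> (C *v v)) < e"
      proof eventually_elim
        case (elim n)
        have "\<bar>v \<bullet> (ppca_cov (T n (y n)) *v v) - v \<bullet> (C *v v)\<bar> \<le> \<delta> * (v \<bullet> (C *v v))"
          by (rule \<epsilon>(2)[OF elim(3,2) T_params[OF elim(3)] arg_max[OF elim(3,1)]])
        with \<delta>(2) show ?case by (simp add: dist_real_def b_def)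
      qed
    qed
  qed
  then show ?thesis by (simp add: y_def C_def)
qed

theorem theorem5p4:
  fixes M :: "'a measure"
    and X :: "nat \<Rightarrow> 'a \<Rightarrow> real^'p"
    and \<theta>\<^sub>0 :: "(real^'q^'p) \<times> real"
    and \<Theta>\<^sub>0 :: "((real^'q^'p) \<times> real) set"
    and T :: "nat \<Rightarrow> (nat \<Rightarrow> real^'p) \<Rightarrow> (real^'q^'p) \<times> real"
  assumes "CARD('q) < CARD('p)"
    and "prob_space M"
    and "\<theta>\<^sub>0 \<in> ppca_params"
    and "prob_space.indep_vars M (\<lambda>_. borel) X UNIV"
    and "\<And>i. distributed M lborel (X i) (\<lambda>x. ennreal (ppca_density \<theta>\<^sub>0 x))"
    and "compact \<Theta>\<^sub>0" and "\<Theta>\<^sub>0 \<subseteq> ppca_params" and "\<theta>\<^sub>0 \<in> \<Theta>\<^sub>0"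
    and "\<And>n. n \<ge> 1 \<Longrightarrow> ppca_mle n (T n)"
  shows "measure M {\<omega> \<in> space M.
    (\<lambda>n. ppca_cov (T n (\<lambda>i\<in>{..<n}. X i \<omega>))) \<longlonglongrightarrow> ppca_cov \<theta>\<^sub>0} = 1"
proof -
  interpret prob_space M by fact
  have X_m: "X i \<in> borel_measurable M" for i
    using distributed_measurable[OF assms(5), of i] by simp
  define f where "f n \<omega> = ppca_cov (T n (\<lambda>i\<in>{..<n}. X i \<omega>))" for n \<omega>
  have "f n \<in> borel_measurable M" if "n \<ge> 1" for n
  proof -
    have "(\<lambda>\<omega>. \<lambda>i\<in>{..<n}. X i \<omega>) \<in> measurable M (Pi\<^sub>M {..<n} (\<lambda>_. borel))"
      by (rule measurable_restrict) (rule X_m)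
    moreover have "T n \<in> borel_measurable (Pi\<^sub>M {..<n} (\<lambda>_. borel))"
      using assms(9)[OF that] by (simp add: ppca_mle_def)
    moreover have "ppca_cov \<in> borel_measurable borel"
      by (rule borel_measurable_continuous_onI[OF continuous_on_ppca_cov])
    ultimately show ?thesis
      unfolding f_def by (intro measurable_compose[of _ M _ ppca_cov] measurable_compose[of _ M _ "T n"])
  qed
  \<comment> \<open>Measurability of \<open>T 0\<close> is not assumed, so the event is described by
    the shifted sequence, which has the same limit.\<close>
  then have "{\<omega> \<in> space M. (\<lambda>n. f (Suc n) \<omega>) \<longlonglongrightarrow> ppca_cov \<theta>\<^sub>0} \<in> events"
    by (intro sets_Collect_LIMSEQ) simp
  then have meas: "{\<omega> \<in> space M. (\<lambda>n. f n \<omega>) \<longlonglongrightarrow> ppca_cov \<theta>\<^sub>0} \<in> events"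
    by (simp only: filterlim_sequentially_Suc[of "\<lambda>n. f n _"])
  have "AE \<omega> in M. \<forall>\<epsilon>>0. \<forall>\<^sub>F n in sequentially. second_moments_close \<epsilon> (ppca_cov \<theta>\<^sub>0) n (\<lambda>i. X i \<omega>)"
    using assms(5)
    by (intro AE_eventually_second_moments_close pos_def_ppca_cov assms(3,4)) (simp add: ppca_density_def)
  then have "AE \<omega> in M. (\<lambda>n. f n \<omega>) \<longlonglongrightarrow> ppca_cov \<theta>\<^sub>0"
    unfolding f_def
    by eventually_elim (intro ppca_mle_covariance_tendsto assms(1,3,9), auto)
  with prob_Collect_eq_1[OF meas] show ?thesis by (simp add: f_def)
qed

end
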